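(* Let $\mu_1\ge\cdots\ge\mu_{d-m}>0$ be the eigenvalues of $T_{m,\perp}$, let $S_\perp=T_{m,\perp}-\gamma e_1e_1^{\top}$ with $\gamma=\beta_m^2(T_m^{-1})_{mm}\ge0$, let $\mu_1^S\ge\cdots\ge\mu_{d-m}^S$ be the eigenvalues of $S_\perp$, and let $\lambda_1\ge\cdots\ge\lambda_d>0$ be the eigenvalues of $A$. Then: (i) (Interlacing) $\mu_j\ge\mu_j^S\ge\mu_{j+1}$ for $1\le j\le d-m$, with the convention $\mu_{d-m+1}=0$. In particular $\mu_1^S\le\mu_1$. (ii) (Well-posedness) $S_\perp$ is positive definite if and only if $\gamma\,(T_{m,\perp}^{-1})_{11}<1$, and this condition holds automatically, since $S_\perp^{-1}=Q_{m,\perp}^{\top}A^{-1}Q_{m,\perp}$. (iii) (Spectral floor) $\mu_{d-m}^S\ge\lambda_d$. (iv) (Condition number) With $\kappa_S^\perp(m)=\mu_1^S/\mu_{d-m}^S$, $$\kappa_S^\perp(m)\le\frac{\mu_1}{\lambda_d}\le\kappa(A)=\frac{\lambda_1}{\lambda_d}.$$ (v) (Bulk block of the inverse) Assume $d-m\ge2$, let $\hat u=S_\perp^{-1}e_1/\|S_\perp^{-1}e_1\|_2\in\mathbb{R}^{d-m}$, and let $V\in\mathbb{R}^{(d-m)\times(d-m-1)}$ be an isometry whose columns span $\hat u^\perp=\{x\in\mathbb{R}^{d-m}:x^{\top}\hat u=0\}$. The eigenvalues $\delta_1\ge\cdots\ge\delta_{d-m-1}$ of $D=V^{\top}S_\perp^{-1}V$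 interlace those of $S_\perp^{-1}$; hence $\delta_i\in[1/\mu_1^S,\,1/\mu_{d-m}^S]$ for all $i$ and $\delta_1/\delta_{d-m-1}\le\kappa_S^\perp(m)$.
   Context: $A\in\mathbb{R}^{d\times d}$ is symmetric positive definite and $1\le m<d$. Starting from a unit vector $q_1=v_{\mathrm{ref}}/\|v_{\mathrm{ref}}\|_2$, $m$ steps of the Lanczos algorithm (exact arithmetic, no breakdown before step $m$) produce $Q_m=[q_1,\dots,q_m]\in\mathbb{R}^{d\times m}$ with orthonormal columns, a symmetric tridiagonal positive definite matrix $T_m=Q_m^{\top}AQ_m$, a scalar $\beta_m\ge0$, and a unit vector $q_{m+1}\perp\mathrm{range}(Q_m)$ (any such unit vector if $\beta_m=0$) with $AQ_m=Q_mT_m+\beta_mq_{m+1}e_m^{\top}$. $Q_{m,\perp}\in\mathbb{R}^{d\times(d-m)}$ has orthonormal columns spanning the orthogonal complement of $\mathrm{range}(Q_m)$, with first column $q_{m+1}$; $T_{m,\perp}=Q_{m,\perp}^{\top}AQ_{m,\perp}$. $e_m\in\mathbb{R}^m$ is the last and $e_1\in\mathbb{R}^{d-m}$ the first coordinate vector. The interlacing in (v) means: if $s_1\ge\dots\ge s_{d-m}$ are the eigenvalues of $S_\perp^{-1}$, then $s_i\ge\delta_i\ge s_{i+1}$. The vector $\hat u$ gives the coordinates, in the basis $Q_{m,\perp}$, of $u=q_\perp/\|q_\perp\|_2$ with $q_\perp=Q_{m,\perp}S_\perp^{-1}e_1$. *)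

theory Defs
  imports
    "Jordan_Normal_Form.Char_Poly"
    "Jordan_Normal_Form.VS_Connect"
    "Jordan_Normal_Form.Gauss_Jordan_Elimination"
begin

definition vnorm :: "real vec \<Rightarrow> real" where
  "vnorm x = sqrt (x \<bullet> x)"

definition pos_def :: "real mat \<Rightarrow> bool" where
  "pos_def A \<longleftrightarrow> A\<^sup>T = A \<and>
     (\<forall>x \<in> carrier_vec (dim_row A). x \<noteq> 0\<^sub>v (dim_row A) \<longrightarrow> x \<bullet> (A *\<^sub>v x) > 0)"

text \<open>Only meaningful for invertible matrices (the library function is partial).\<close>
definition minv :: "real mat \<Rightarrow> real mat" where
  "minv A = the (mat_inverse A)"

definition outer_prod :: "real vec \<Rightarrow> real vec \<Rightarrow> real mat" where
  "outer_prod x y = mat (dim_vec x) (dim_vec y) (\<lambda>(i, j). x $ i * y $ j)"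

text \<open>The real eigenvalues, repeated according to algebraic multiplicity, in non-increasing
  order; \<open>eigval A j\<close> is the \<open>j\<close>-th largest one, counting from 1.  For a symmetric matrix
  of size \<open>n\<close> the list has length \<open>n\<close>.\<close>
definition eigvals :: "real mat \<Rightarrow> real list" where
  "eigvals A = rev (sorted_list_of_multiset (proots (char_poly A)))"

definition eigval :: "real mat \<Rightarrow> nat \<Rightarrow> real" where
  "eigval A j = eigvals A ! (j - 1)"

definition cond_num :: "real mat \<Rightarrow> real" where
  "cond_num A = eigval A 1 / eigval A (dim_row A)"

text \<open>The Lanczos iteration for \<open>A\<close> started at \<open>v\<close>, with vectors and coefficients numbered
  from 1: \<open>\<beta> j * q (j + 1) = A q j - \<alpha> j * q j - \<beta> (j - 1) * q (j - 1)\<close>, where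
  \<open>\<alpha> j\<close> is the inner product of \<open>q j\<close> and \<open>A q j\<close>, and the last term is absent for
  \<open>j = 1\<close>.\<close>
definition lanczos_residual ::
    "real mat \<Rightarrow> (nat \<Rightarrow> real vec) \<Rightarrow> (nat \<Rightarrow> real) \<Rightarrow> nat \<Rightarrow> real vec" where
  "lanczos_residual A q \<beta> j =
     A *\<^sub>v q j - (q j \<bullet> (A *\<^sub>v q j)) \<cdot>\<^sub>v q j
       - (if j = 1 then 0\<^sub>v (dim_row A) else \<beta> (j - 1) \<cdot>\<^sub>v q (j - 1))"

text \<open>\<open>m\<close> steps without breakdown before step \<open>m\<close>.  If \<open>\<beta> m = 0\<close>, then \<open>q (m + 1)\<close> is
  an arbitrary unit vector orthogonal to the previous ones.\<close>
definition lanczos ::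
    "real mat \<Rightarrow> real vec \<Rightarrow> nat \<Rightarrow> (nat \<Rightarrow> real vec) \<Rightarrow> (nat \<Rightarrow> real) \<Rightarrow> bool" where
  "lanczos A v m q \<beta> \<longleftrightarrow>
     q 1 = (1 / vnorm v) \<cdot>\<^sub>v v \<and>
     (\<forall>j \<in> {1..m}. \<beta> j = vnorm (lanczos_residual A q \<beta> j)) \<and>
     (\<forall>j \<in> {1..<m}. \<beta> j \<noteq> 0) \<and>
     (\<forall>j \<in> {1..m}. \<beta> j \<noteq> 0 \<longrightarrow>
        q (Suc j) = (1 / \<beta> j) \<cdot>\<^sub>v lanczos_residual A q \<beta> j) \<and>
     (\<beta> m = 0 \<longrightarrow>
        q (Suc m) \<in> carrier_vec (dim_row A) \<and> vnorm (q (Suc m)) = 1 \<and>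
        (\<forall>i \<in> {1..m}. q (Suc m) \<bullet> q i = 0))"

text \<open>The data produced by the iteration: orthonormal vectors, a tridiagonal projected matrix
  with off-diagonal entries \<open>\<beta>\<close>, and the relation \<open>A Q = Q T + \<beta> m * q (m + 1) e\<^sub>m\<^sup>T\<close>.\<close>
context
  fixes A :: "real mat" and v :: "real vec" and d m :: nat
    and q :: "nat \<Rightarrow> real vec" and \<beta> :: "nat \<Rightarrow> real"
  assumes A: "A \<in> carrier_mat d d" and sym: "A\<^sup>T = A"
    and v: "v \<in> carrier_vec d" "v \<noteq> 0\<^sub>v d"
    and lan: "lanczos A v m q \<beta>"
begin

lemma sym_sprod:
  assumes "x \<in> carrier_vec d" "y \<in> carrier_vec d"
  shows "x \<bullet> (A *\<^sub>v y) = y \<bullet> (A *\<^sub>v x)"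
proof -
  have "x \<bullet> (A *\<^sub>v y) = (A\<^sup>T *\<^sub>v x) \<bullet> y"
    using transpose_vec_mult_scalar[OF A assms(2,1)] by simp
  also have "\<dots> = y \<bullet> (A *\<^sub>v x)"
    unfolding sym by (rule comm_scalar_prod[of _ d]) (use A assms in auto)
  finally show ?thesis .
qed

lemma sprod_self_ge_0: "(x :: real vec) \<bullet> x \<ge> 0"
  unfolding scalar_prod_def by (intro sum_nonneg) simp

lemma sprod_self_eq_0:
  assumes "x \<in> carrier_vec d" "x \<bullet> x = (0::real)" shows "x = 0\<^sub>v d"
proof -
  have "\<forall>i \<in> {0..<dim_vec x}. x $ i * x $ i = 0"
    using assms(2) unfolding scalar_prod_def by (subst (asm) sum_nonneg_eq_0_iff) auto
  then show ?thesis using assms(1) by (intro eq_vecI) auto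
qed

lemma lanczos_carrier_aux:
  assumes "k \<le> m" shows "\<forall>j \<in> {1..Suc k}. q j \<in> carrier_vec d"
  using assms
proof (induction k)
  case 0
  then show ?case using lan v unfolding lanczos_def by auto
next
  case (Suc k)
  then have IH: "\<forall>j \<in> {1..Suc k}. q j \<in> carrier_vec d" by simp
  then have r: "lanczos_residual A q \<beta> (Suc k) \<in> carrier_vec d"
    using A unfolding lanczos_residual_def by auto
  have "q (Suc (Suc k)) \<in> carrier_vec d"
  proof (cases "\<beta> (Suc k) = 0")
    case True
    then have "Suc k = m" using lan Suc.prems unfolding lanczos_def
      by (metis atLeastLessThan_iff le_add1 le_neq_implies_less plus_1_eq_Suc)
    with True show ?thesis using lan A unfolding lanczos_def by auto
  next
    case False
    then show ?thesis using lan r Suc.prems unfolding lanczos_def by auto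
  qed
  with IH show ?case by (auto simp: le_Suc_eq)
qed

lemma lanczos_carrier: "1 \<le> j \<Longrightarrow> j \<le> Suc m \<Longrightarrow> q j \<in> carrier_vec d"
  using lanczos_carrier_aux[of m] by auto

lemma lanczos_step:
  assumes j: "1 \<le> j" "j \<le> m" and w: "w \<in> carrier_vec d"
  shows "w \<bullet> (A *\<^sub>v q j) = (q j \<bullet> (A *\<^sub>v q j)) * (w \<bullet> q j)
    + (if j = 1 then 0 else \<beta> (j - 1) * (w \<bullet> q (j - 1))) + \<beta> j * (w \<bullet> q (Suc j))"
proof -
  let ?r = "lanczos_residual A q \<beta> j"
  have c: "q j \<in> carrier_vec d" "q (Suc j) \<in> carrier_vec d"
    using lanczos_carrier j by auto
  have c': "q (j - 1) \<in> carrier_vec d" if "j \<noteq> 1"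
    using lanczos_carrier[of "j - 1"] j that by auto
  have r: "?r \<in> carrier_vec d"
    using A c c' unfolding lanczos_residual_def by auto
  have "?r = \<beta> j \<cdot>\<^sub>v q (Suc j)"
  proof (cases "\<beta> j = 0")
    case True
    moreover have "\<beta> j = vnorm ?r" using lan j unfolding lanczos_def by auto
    ultimately have "?r = 0\<^sub>v d" using r sprod_self_eq_0 unfolding vnorm_def by auto
    with True c show ?thesis by auto
  next
    case False
    then have "q (Suc j) = (1 / \<beta> j) \<cdot>\<^sub>v ?r" using lan j unfolding lanczos_def by auto
    with False show ?thesis by (simp add: smult_smult_assoc)
  qed
  then have "w \<bullet> ?r = \<beta> j * (w \<bullet> q (Suc j))" using w c by simp
  moreover have "w \<bullet> ?r = w \<bullet> (A *\<^sub>v q j) - (q j \<bullet> (A *\<^sub>v q j)) * (w \<bullet> q j)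
      - (if j = 1 then 0 else \<beta> (j - 1) * (w \<bullet> q (j - 1)))"
    using A w c c' unfolding lanczos_residual_def
    by (auto simp: scalar_prod_minus_distrib[of _ d])
  ultimately show ?thesis by simp
qed

lemma lanczos_orthonormal_aux:
  assumes "k \<le> m"
  shows "\<forall>i \<in> {1..Suc k}. \<forall>j \<in> {1..Suc k}. q i \<bullet> q j = (if i = j then 1 else 0)"
  using assms
proof (induction k)
  case 0
  have "v \<bullet> v > 0"
    using v sprod_self_eq_0[of v] sprod_self_ge_0[of v] by force
  then show ?case using lan v unfolding lanczos_def vnorm_def by auto
next
  case (Suc k)
  then have IH: "\<And>i j. i \<in> {1..Suc k} \<Longrightarrow> j \<in> {1..Suc k} \<Longrightarrow>
      q i \<bullet> q j = (if i = j then 1 else 0)" by simp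
  let ?K = "Suc k" let ?r = "lanczos_residual A q \<beta> ?K"
  have c: "q j \<in> carrier_vec d" if "1 \<le> j" "j \<le> Suc ?K" for j
    using lanczos_carrier that Suc.prems by auto
  have new: "q (Suc ?K) \<bullet> q (Suc ?K) = 1 \<and> (\<forall>i \<in> {1..?K}. q i \<bullet> q (Suc ?K) = 0)"
  proof (cases "\<beta> ?K = 0")
    case True
    then have K: "?K = m" using lan Suc.prems unfolding lanczos_def
      by (metis atLeastLessThan_iff le_add1 le_neq_implies_less plus_1_eq_Suc)
    have n: "q (Suc ?K) \<bullet> q (Suc ?K) = 1" and o: "q (Suc ?K) \<bullet> q i = 0" if "i \<in> {1..?K}" for i
      using True K lan that unfolding lanczos_def vnorm_def by auto
    have "q i \<bullet> q (Suc ?K) = 0" if i: "i \<in> {1..?K}" for i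
      using comm_scalar_prod[of "q i" d "q (Suc ?K)"] c[of i] c[of "Suc ?K"] o[OF i] i by simp
    with n[of 1] show ?thesis by auto
  next
    case False
    have rc: "?r \<in> carrier_vec d"
      using A c[of ?K] c[of k] unfolding lanczos_residual_def by auto
    have q: "q (Suc ?K) = (1 / \<beta> ?K) \<cdot>\<^sub>v ?r" and b: "\<beta> ?K = sqrt (?r \<bullet> ?r)"
      using False lan Suc.prems unfolding lanczos_def vnorm_def by auto
    have "?r \<bullet> ?r = \<beta> ?K * \<beta> ?K"
      unfolding b using sprod_self_ge_0[of ?r] by simp
    then have unit: "q (Suc ?K) \<bullet> q (Suc ?K) = 1"
      unfolding q using False rc by simp
    have "q i \<bullet> q (Suc ?K) = 0" if i: "i \<in> {1..?K}" for i
    proof -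
      have step: "q i \<bullet> (A *\<^sub>v q ?K) = (q ?K \<bullet> (A *\<^sub>v q ?K)) * (q i \<bullet> q ?K)
        + (if ?K = 1 then 0 else \<beta> k * (q i \<bullet> q k)) + \<beta> ?K * (q i \<bullet> q (Suc ?K))"
        using lanczos_step[of ?K "q i"] c i Suc.prems by auto
      show ?thesis
      proof (cases "i = ?K")
        case True
        have "(if ?K = 1 then 0 else \<beta> k * (q i \<bullet> q k)) = 0"
          using True IH[of ?K k] by auto
        then show ?thesis using step False True IH[of ?K ?K] by simp
      next
        case ne: False
        have "q i \<bullet> (A *\<^sub>v q ?K) = q ?K \<bullet> (A *\<^sub>v q i)"
          using sym_sprod c[of i] c[of ?K] i by auto
        also have "\<dots> = (q i \<bullet> (A *\<^sub>v q i)) * (q ?K \<bullet> q i)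
          + (if i = 1 then 0 else \<beta> (i - 1) * (q ?K \<bullet> q (i - 1))) + \<beta> i * (q ?K \<bullet> q (Suc i))"
          using lanczos_step[of i "q ?K"] c[of ?K] i Suc.prems by simp
        also have "(if i = 1 then 0 else \<beta> (i - 1) * (q ?K \<bullet> q (i - 1))) = 0"
          using IH[of ?K "i - 1"] i ne by (cases i; cases "i - 1") auto
        also have "q ?K \<bullet> q i = 0" using IH[of ?K i] i ne by auto
        also have "\<beta> i * (q ?K \<bullet> q (Suc i)) = (if i = k then \<beta> k else 0)"
          using IH[of ?K "Suc i"] i ne by auto
        finally have 1: "q i \<bullet> (A *\<^sub>v q ?K) = (if i = k then \<beta> k else 0)" by simp
        have 2: "(if ?K = 1 then 0 else \<beta> k * (q i \<bullet> q k)) = (if i = k then \<beta> k else 0)"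
          using IH[of i k] i ne by auto
        have 3: "q i \<bullet> q ?K = 0" using IH[of i ?K] i ne by auto
        from step[unfolded 1 2 3] False show ?thesis by simp
      qed
    qed
    with unit show ?thesis by blast
  qed
  have comm: "q (Suc ?K) \<bullet> q i = q i \<bullet> q (Suc ?K)" if "i \<in> {1..?K}" for i
    using c[of i] c[of "Suc ?K"] that by (intro comm_scalar_prod[of _ d]) auto
  have ins: "{1..Suc ?K} = insert (Suc ?K) {1..?K}" by auto
  have "q i \<bullet> q j = (if i = j then 1 else 0)"
    if "i = Suc ?K \<or> i \<in> {1..?K}" "j = Suc ?K \<or> j \<in> {1..?K}" for i j
    using that(1)
  proof
    assume i: "i = Suc ?K"
    show ?thesis using that(2)
    proof
      assume "j = Suc ?K" with i new show ?thesis by simp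
    next
      assume j: "j \<in> {1..?K}"
      then have "j \<noteq> Suc ?K" by auto
      with i new comm[OF j] j show ?thesis by simp
    qed
  next
    assume i: "i \<in> {1..?K}"
    show ?thesis using that(2)
    proof
      assume j: "j = Suc ?K"
      with i have "i \<noteq> j" by auto
      with i j new show ?thesis by simp
    next
      assume "j \<in> {1..?K}" with i IH show ?thesis by blast
    qed
  qed
  then show ?case unfolding ins by blast
qed

lemma lanczos_orthonormal:
  assumes "i \<in> {1..Suc m}" "j \<in> {1..Suc m}"
  shows "q i \<bullet> q j = (if i = j then 1 else 0)"
  using lanczos_orthonormal_aux[of m] assms by simp

lemma lanczos_tridiagonal:
  assumes "i \<in> {1..m}" "j \<in> {1..m}"
  shows "q i \<bullet> (A *\<^sub>v q j) =
    (if i = j then q j \<bullet> (A *\<^sub>v q j) else if i = Suc j then \<beta> j else if j = Suc i then \<beta> i else 0)"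
proof -
  have o: "q i \<bullet> q k = (if i = k then 1 else 0)" if "k \<in> {1..Suc m}" for k
    using lanczos_orthonormal[of i k] assms that by auto
  have "q i \<bullet> (A *\<^sub>v q j) = (q j \<bullet> (A *\<^sub>v q j)) * (if i = j then 1 else 0)
      + (if j = 1 then 0 else \<beta> (j - 1) * (if i = j - 1 then 1 else 0))
      + \<beta> j * (if i = Suc j then 1 else 0)"
    using lanczos_step[of j "q i"] assms lanczos_carrier[of i] o[of j] o[of "j - 1"] o[of "Suc j"]
    by (cases j; cases "j - 1") auto
  then show ?thesis using assms by auto
qed

lemma lanczos_decomposition:
  assumes Q: "Q = mat_of_cols d (map q [1..<Suc m])" and m: "1 \<le> m"
  shows "Q \<in> carrier_mat d m" "Q\<^sup>T * Q = 1\<^sub>m m"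
    "A * Q = Q * (Q\<^sup>T * A * Q) + \<beta> m \<cdot>\<^sub>m outer_prod (q (Suc m)) (unit_vec m (m - 1))"
proof -
  show Qc: "Q \<in> carrier_mat d m" unfolding Q by (auto simp del: upt_Suc)
  have col: "col Q j = q (Suc j)" if "j < m" for j
    unfolding Q using that lanczos_carrier[of "Suc j"]
    by (subst col_mat_of_cols) (auto simp del: upt_Suc)
  show "Q\<^sup>T * Q = 1\<^sub>m m"
    by (rule eq_matI) (use Qc col lanczos_orthonormal in auto)
  have AQcol: "col (A * Q) j = A *\<^sub>v q (Suc j)" if "j < m" for j
    using col_mult2[OF A Qc that] col[OF that] by simp
  have "Q\<^sup>T * A * Q = Q\<^sup>T * (A * Q)" using A Qc by (intro assoc_mult_mat) auto
  then have T: "(Q\<^sup>T * A * Q) $$ (i, j) = q (Suc i) \<bullet> (A *\<^sub>v q (Suc j))"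
    if "i < m" "j < m" for i j using that A Qc col AQcol by simp
  show "A * Q = Q * (Q\<^sup>T * A * Q) + \<beta> m \<cdot>\<^sub>m outer_prod (q (Suc m)) (unit_vec m (m - 1))"
    (is "?L = ?R")
  proof (rule eq_matI)
    have dq: "dim_vec (q (Suc m)) = d" using lanczos_carrier[of "Suc m"] by simp
    show "dim_row ?L = dim_row ?R" "dim_col ?L = dim_col ?R"
      using A Qc dq by (auto simp: outer_prod_def)
    fix i j assume "i < dim_row ?R" "j < dim_col ?R"
    then have i: "i < d" and j: "j < m" using Qc dq by (auto simp: outer_prod_def)
    let ?a = "q (Suc j) \<bullet> (A *\<^sub>v q (Suc j))"
    have Qe: "Q $$ (i, k) = q (Suc k) $ i" if "k < m" for k
      using Qc col[OF that] that i by (metis carrier_matD index_col)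
    have "(Q * (Q\<^sup>T * A * Q)) $$ (i, j) = (\<Sum>k<m. Q $$ (i, k) * (Q\<^sup>T * A * Q) $$ (k, j))"
      using Qc A i j by (simp add: scalar_prod_def atLeast0LessThan)
    also have "\<dots> = (\<Sum>k<m. (if k = j then ?a * q (Suc j) $ i else 0)
        + (if k = j - 1 then (if j = 0 then 0 else \<beta> j * q j $ i) else 0)
        + (if k = Suc j then \<beta> (Suc j) * q (Suc (Suc j)) $ i else 0))"
    proof (rule sum.cong)
      fix k assume "k \<in> {..<m}"
      then have k: "k < m" by simp
      show "Q $$ (i, k) * (Q\<^sup>T * A * Q) $$ (k, j) = (if k = j then ?a * q (Suc j) $ i else 0)
        + (if k = j - 1 then (if j = 0 then 0 else \<beta> j * q j $ i) else 0)
        + (if k = Suc j then \<beta> (Suc j) * q (Suc (Suc j)) $ i else 0)"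
        unfolding Qe[OF k] T[OF k j]
        using lanczos_tridiagonal[of "Suc k" "Suc j"] k j by (cases j) auto
    qed simp
    also have "\<dots> = ?a * q (Suc j) $ i + (if j = 0 then 0 else \<beta> j * q j $ i)
        + (if Suc j < m then \<beta> (Suc j) * q (Suc (Suc j)) $ i else 0)"
      using j by (simp add: sum.distrib)
    finally have 1: "(Q * (Q\<^sup>T * A * Q)) $$ (i, j) = \<dots>" .
    have "?L $$ (i, j) = (A *\<^sub>v q (Suc j)) $ i"
      using AQcol[OF j] A Qc i j by (metis carrier_matD index_col index_mult_mat(2,3))
    also have "\<dots> = unit_vec d i \<bullet> (A *\<^sub>v q (Suc j))"
      by (rule scalar_prod_left_unit[symmetric]) (use A i lanczos_carrier[of "Suc j"] j in auto)
    also have "\<dots> = ?a * (unit_vec d i \<bullet> q (Suc j))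
        + (if j = 0 then 0 else \<beta> j * (unit_vec d i \<bullet> q j))
        + \<beta> (Suc j) * (unit_vec d i \<bullet> q (Suc (Suc j)))"
      using lanczos_step[of "Suc j" "unit_vec d i"] j by simp
    also have "\<dots> = ?a * q (Suc j) $ i + (if j = 0 then 0 else \<beta> j * q j $ i)
        + \<beta> (Suc j) * q (Suc (Suc j)) $ i"
      using i j lanczos_carrier[of j] lanczos_carrier[of "Suc j"] lanczos_carrier[of "Suc (Suc j)"]
      by (simp add: scalar_prod_left_unit[of _ d])
    finally show "?L $$ (i, j) = ?R $$ (i, j)"
      using 1 i j Qc A dq m by (cases "Suc j = m") (auto simp: outer_prod_def)
  qed
qed

end

end

theory Submission
  imports Defs "Jordan_Normal_Form.Schur_Decomposition"
begin

text \<open>The Lanczos relation gives \<open>Q\<^sub>\<perp>\<^sup>T A Q = \<beta>\<^sub>m e\<^sub>1 e\<^sub>m\<^sup>T\<close>, so the rank-one correction \<open>\<gamma> e\<^sub>1 e\<^sub>1\<^sup>T\<close> turns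
  \<open>S\<close> into the Schur complement of \<open>T\<close> in the matrix of \<open>A\<close> with respect to \<open>[Q, Q\<^sub>\<perp>]\<close>.  Hence
  \<open>S\<^sup>-\<^sup>1\<close> is the compression of \<open>A\<^sup>-\<^sup>1\<close> to the range of \<open>Q\<^sub>\<perp>\<close>, and \<open>x\<^sup>T S x = w\<^sup>T A w\<close> for some \<open>w\<close> that is at
  least as long as \<open>x\<close>, which yields the spectral floor.  All interlacing inequalities are
  instances of one comparison principle: subspaces spanned by top eigenvectors of one matrix and
  bottom eigenvectors of another intersect as soon as their dimensions add up to more than that
  of the ambient space.\<close>

section \<open>Scalar products, transposes and orthonormal bases\<close>

lemma scalar_prod_self_nonneg: "(x :: real vec) \<bullet> x \<ge> 0"
  unfolding scalar_prod_def by (intro sum_nonneg) simp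

lemma scalar_prod_self_pos:
  fixes x :: "real vec"
  assumes "x \<in> carrier_vec n" "x \<noteq> 0\<^sub>v n"
  shows "x \<bullet> x > 0"
  using conjugate_square_greater_0_vec[OF assms(1)] assms by simp

lemma scalar_prod_adjoint:
  fixes A :: "'a :: comm_semiring_0 mat"
  assumes A: "A \<in> carrier_mat n k" and x: "x \<in> carrier_vec n" and y: "y \<in> carrier_vec k"
  shows "x \<bullet> (A *\<^sub>v y) = (A\<^sup>T *\<^sub>v x) \<bullet> y"
  by (rule transpose_vec_mult_scalar[OF A y x, symmetric])

lemma transpose_mult3:
  fixes A B C :: "'a :: comm_semiring_0 mat"
  assumes "A \<in> carrier_mat n k" "B \<in> carrier_mat k l" "C \<in> carrier_mat l p"
  shows "(A * B * C)\<^sup>T = C\<^sup>T * B\<^sup>T * A\<^sup>T"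
proof -
  have "(A * B * C)\<^sup>T = C\<^sup>T * (A * B)\<^sup>T"
    by (rule transpose_mult) (use assms in auto)
  also have "(A * B)\<^sup>T = B\<^sup>T * A\<^sup>T"
    by (rule transpose_mult) (use assms in auto)
  also have "C\<^sup>T * (B\<^sup>T * A\<^sup>T) = C\<^sup>T * B\<^sup>T * A\<^sup>T"
    by (rule assoc_mult_mat[symmetric]) (use assms in auto)
  finally show ?thesis .
qed

lemma congruence_symmetric:
  fixes A :: "'a :: comm_semiring_0 mat"
  assumes "A \<in> carrier_mat n n" "A\<^sup>T = A" "W \<in> carrier_mat n k"
  shows "(W\<^sup>T * A * W)\<^sup>T = W\<^sup>T * A * W"
  using transpose_mult3[of "W\<^sup>T" k n A n W k] assms by simp

text \<open>Gram-Schmidt keeps the first vector of the completed basis unchanged and yields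
  orthogonal, unscaled vectors; normalising each column afterwards gives an orthogonal matrix that
  starts with the direction of \<open>v\<close>. With an eigenvector as \<open>v\<close> this is the
  deflation step of the spectral theorem.\<close>

lemma orthonormal_completion:
  fixes v :: "real vec"
  assumes v: "v \<in> carrier_vec n" "v \<noteq> 0\<^sub>v n"
  shows "\<exists>W \<in> carrier_mat n n. W\<^sup>T * W = 1\<^sub>m n \<and> col W 0 = (1 / vnorm v) \<cdot>\<^sub>v v"
proof -
  interpret cof_vec_space n "TYPE(real)" .
  note bc = basis_completion[OF v]
  define ws where "ws = gram_schmidt n (basis_completion v)"
  note gs = gram_schmidt_result[OF bc(2,4,5) ws_def]
  have n: "0 < n" using v by (cases n) auto
  have len: "length ws = n" using gs(4) bc(6) by simp
  have hd: "ws ! 0 = v"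
  proof -
    obtain vs where "basis_completion v = v # vs"
      using bc(6,7) n by (cases "basis_completion v") auto
    then have "hd ws = v" unfolding ws_def using v by simp
    then show ?thesis using len n by (metis hd_conv_nth length_0_conv less_numeral_extra(3))
  qed
  have c: "ws ! i \<in> carrier_vec n" if "i < n" for i using gs(3) len that by auto
  have o: "(ws ! i \<bullet> ws ! j = 0) = (i \<noteq> j)" if "i < n" "j < n" for i j
    using corthogonalD[OF gs(2), of i j] len that by simp
  define W where "W = mat_of_cols n (map (\<lambda>w. (1 / vnorm w) \<cdot>\<^sub>v w) ws)"
  have W: "W \<in> carrier_mat n n" unfolding W_def using len by auto
  have col: "col W i = (1 / vnorm (ws ! i)) \<cdot>\<^sub>v ws ! i" if "i < n" for i
    unfolding W_def using len that c by (subst col_mat_of_cols) auto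
  have "W\<^sup>T * W = 1\<^sub>m n"
  proof (rule eq_matI)
    fix i j assume ij: "i < dim_row (1\<^sub>m n :: real mat)" "j < dim_col (1\<^sub>m n :: real mat)"
    have p: "ws ! j \<bullet> ws ! j > 0" using o[of j j] ij scalar_prod_self_nonneg[of "ws ! j"] by auto
    have "(W\<^sup>T * W) $$ (i, j) = 1 / vnorm (ws ! i) * (1 / vnorm (ws ! j) * (ws ! i \<bullet> ws ! j))"
      using W ij col carrier_vecD[OF c] by simp
    also have "\<dots> = 1\<^sub>m n $$ (i, j)"
      using o[of i j] ij p by (cases "i = j") (auto simp: vnorm_def)
    finally show "(W\<^sup>T * W) $$ (i, j) = 1\<^sub>m n $$ (i, j)" .
  qed (use W in auto)
  with W col[OF n] hd show ?thesis by auto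
qed

subsection \<open>Spectral decomposition of real symmetric matrices\<close>

text \<open>The form of \<open>v\<close> with \<open>A\<close> applied to its conjugate is evaluated
  twice: moving \<open>A\<close> to the left factor produces \<open>z\<close>, pulling the
  conjugation out of the product produces \<open>cnj z\<close>. The common factor is the squared
  norm of \<open>v\<close>, which is nonzero.\<close>

lemma symmetric_eigenvalue_real:
  fixes A :: "real mat"
  assumes A: "A \<in> carrier_mat n n" "A\<^sup>T = A"
    and z: "eigenvalue (map_mat complex_of_real A) z"
  shows "z \<in> \<real>"
proof -
  let ?A = "map_mat complex_of_real A"
  have Ac: "?A \<in> carrier_mat n n" using A by simp
  obtain v where v: "v \<in> carrier_vec n" "v \<noteq> 0\<^sub>v n" and ev: "?A *\<^sub>v v = z \<cdot>\<^sub>v v"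
    using z A unfolding eigenvalue_def eigenvector_def by auto
  let ?w = "conjugate v"
  have w: "?w \<in> carrier_vec n" using v by simp
  have sym: "?A\<^sup>T = ?A"
    using A(2) by (metis map_mat_transpose)
  \<comment> \<open>Conjugation commutes with \<open>?A\<close> because its entries are
    real.\<close>
  have cA: "conjugate (?A *\<^sub>v v) = ?A *\<^sub>v ?w"
    by (rule eq_vecI) (use A v in \<open>auto simp: scalar_prod_def\<close>)
  have "v \<bullet> (?A *\<^sub>v ?w) = (?A\<^sup>T *\<^sub>v v) \<bullet> ?w"
    by (rule scalar_prod_adjoint[OF Ac v(1) w])
  also have "\<dots> = z * (v \<bullet> ?w)" unfolding sym ev using v w by simp
  finally have 1: "v \<bullet> (?A *\<^sub>v ?w) = z * (v \<bullet> ?w)" .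
  have "v \<bullet> (?A *\<^sub>v ?w) = cnj z * (v \<bullet> ?w)"
    unfolding cA[symmetric] ev using v w by (simp add: conjugate_smult_vec)
  moreover have "v \<bullet> ?w \<noteq> 0"
    using conjugate_square_eq_0_vec[OF v(1)] v(2) by simp
  ultimately have "cnj z = z" using 1 by simp
  then show ?thesis by (simp add: Reals_cnj_iff)
qed

text \<open>Over the complex numbers the characteristic polynomial splits, and all its roots are
  real by symmetry. The embedding of real polynomials is injective, so the factorisation descends to
  the reals.\<close>

lemma symmetric_char_poly_splits:
  fixes A :: "real mat"
  assumes A: "A \<in> carrier_mat n n" "A\<^sup>T = A"
  shows "\<exists>es. char_poly A = (\<Prod>e\<leftarrow>es. [:- e, 1:])"
proof -
  let ?A = "map_mat complex_of_real A"
  have Ac: "?A \<in> carrier_mat n n" using A by simp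
  obtain as where as: "char_poly ?A = (\<Prod>a\<leftarrow>as. [:- a, 1:])"
    using char_poly_factorized[OF Ac] by auto
  have "a \<in> \<real>" if "a \<in> set as" for a
  proof (rule symmetric_eigenvalue_real[OF A])
    show "eigenvalue ?A a"
      unfolding eigenvalue_root_char_poly[OF Ac] as using that
      by (auto simp: poly_prod_list prod_list_zero_iff)
  qed
  then have "of_real (Re a) = a" if "a \<in> set as" for a using that by simp
  then have "map (complex_of_real \<circ> Re) as = as" by (simp add: map_idI)
  then have as': "as = map complex_of_real (map Re as)" by simp
  interpret P: map_poly_inj_idom_hom complex_of_real ..
  have lin: "map_poly complex_of_real [:- x, 1:] = [:- complex_of_real x, 1:]" for x
    by (simp add: map_poly_pCons)
  have "map_poly complex_of_real (\<Prod>a\<leftarrow>map Re as. [:- a, 1:]) =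
      (\<Prod>a\<leftarrow>map complex_of_real (map Re as). [:- a, 1:])"
    unfolding P.hom_prod_list by (simp add: lin o_def)
  also have "\<dots> = map_poly complex_of_real (char_poly A)"
    unfolding as'[symmetric] as[symmetric] by (rule of_real_hom.char_poly_hom[OF A(1)])
  finally have "char_poly A = (\<Prod>a\<leftarrow>map Re as. [:- a, 1:])" by (simp only: P.eq_iff)
  then show ?thesis by blast
qed

lemma proots_prod_linear: "proots (\<Prod>e\<leftarrow>es. [:- e, 1:]) = mset (es :: 'a :: idom list)"
proof (induction es)
  case (Cons e es)
  have "(\<Prod>e\<leftarrow>es. [:- e, 1:]) \<noteq> 0" by (auto simp: prod_list_zero_iff)
  with Cons show ?case by (simp add: proots_mult del: mult_pCons_left)
qed simp

text \<open>Since \<open>eigvals\<close> collects real roots only, splitting over the reals is what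
  guarantees that none is lost. Sorting merely permutes the linear factors.\<close>

lemma eigvals_char_poly:
  assumes A: "A \<in> carrier_mat n n" "A\<^sup>T = A"
  shows "char_poly A = (\<Prod>e\<leftarrow>eigvals A. [:- e, 1:])"
proof -
  obtain es where es: "char_poly A = (\<Prod>e\<leftarrow>es. [:- e, 1:])"
    using symmetric_char_poly_splits[OF A] by blast
  have "mset (eigvals A) = mset es"
    unfolding eigvals_def es proots_prod_linear by simp
  then have "mset (map (\<lambda>e. [:- e, 1:]) (eigvals A)) = mset (map (\<lambda>e. [:- e, 1:]) es)" by simp
  then show ?thesis unfolding es by (metis prod_mset_prod_list)
qed

lemma length_eigvals:
  assumes A: "A \<in> carrier_mat n n" "A\<^sup>T = A"
  shows "length (eigvals A) = n"
  using degree_linear_factors[of uminus "eigvals A"] eigvals_char_poly[OF A]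
    degree_monic_char_poly[OF A(1)] by simp

lemma eigval_mono:
  assumes A: "A \<in> carrier_mat n n" "A\<^sup>T = A" and ij: "1 \<le> i" "i \<le> j" "j \<le> n"
  shows "eigval A j \<le> eigval A i"
proof -
  have "sorted_wrt (\<ge>) (eigvals A)" unfolding eigvals_def by (simp add: sorted_wrt_rev)
  then show ?thesis unfolding eigval_def
    using ij length_eigvals[OF A] sorted_wrt_nth_less[of "(\<ge>)" "eigvals A" "i - 1" "j - 1"]
    by (cases "i = j") auto
qed

lemma set_eigvals:
  assumes "A \<in> carrier_mat n n"
  shows "e \<in> set (eigvals A) \<longleftrightarrow> eigenvalue A e"
proof -
  have "char_poly A \<noteq> 0" using degree_monic_char_poly[OF assms] by auto
  then show ?thesis unfolding eigvals_def eigenvalue_root_char_poly[OF assms] by simp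
qed

lemma eigenvalue_eigval:
  assumes A: "A \<in> carrier_mat n n" "A\<^sup>T = A" and j: "1 \<le> j" "j \<le> n"
  shows "eigenvalue A (eigval A j)"
  using set_eigvals[OF A(1)] length_eigvals[OF A] j unfolding eigval_def
  by (metis One_nat_def Suc_pred diff_less le_less_trans nth_mem not_le Suc_le_lessD)

lemma eigenvalue_bounds:
  assumes A: "A \<in> carrier_mat n n" "A\<^sup>T = A" and e: "eigenvalue A e"
  shows "eigval A n \<le> e" "e \<le> eigval A 1"
proof -
  obtain k where k: "k < n" "e = eigval A (Suc k)"
    using e length_eigvals[OF A] unfolding eigval_def set_eigvals[OF A(1), symmetric]
    by (auto simp: in_set_conv_nth)
  then show "eigval A n \<le> e" "e \<le> eigval A 1"
    using eigval_mono[OF A, of "Suc k" n] eigval_mono[OF A, of 1 "Suc k"] by auto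
qed

text \<open>Induction by deflation: in an orthonormal basis starting with an eigenvector for
  \<open>e\<close>, the matrix decouples into \<open>e\<close> and a smaller symmetric block whose
  characteristic polynomial has the roots \<open>es\<close>. Keeping the list arbitrary allows any
  order on the diagonal, in particular the sorted one of \<open>eigvals\<close>.\<close>

lemma spectral_decomposition:
  fixes A :: "real mat"
  assumes "A \<in> carrier_mat n n" "A\<^sup>T = A" "char_poly A = (\<Prod>e\<leftarrow>es. [:- e, 1:])"
  shows "\<exists>U \<in> carrier_mat n n. U\<^sup>T * U = 1\<^sub>m n \<and> U\<^sup>T * A * U = mat_diag n (\<lambda>i. es ! i)"
  using assms
proof (induction es arbitrary: n A)
  case Nil
  then have "n = 0" using degree_monic_char_poly[of A n] by auto
  with Nil show ?case by (intro bexI[of _ "1\<^sub>m 0"]) (auto simp: mat_diag_def)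
next
  case (Cons e es)
  note A = Cons.prems(1,2)
  have "length (e # es) = n"
    using degree_linear_factors[of uminus "e # es"] Cons.prems(3) degree_monic_char_poly[OF A(1)] by simp
  then obtain k where n: "n = Suc k" "length es = k" by auto
  have "eigenvalue A e" unfolding eigenvalue_root_char_poly[OF A(1)] Cons.prems(3) by simp
  then obtain v where v: "v \<in> carrier_vec n" "v \<noteq> 0\<^sub>v n" and ev: "A *\<^sub>v v = e \<cdot>\<^sub>v v"
    using A unfolding eigenvalue_def eigenvector_def by auto
  obtain W where W: "W \<in> carrier_mat n n" and WW: "W\<^sup>T * W = 1\<^sub>m n"
    and W0: "col W 0 = (1 / vnorm v) \<cdot>\<^sub>v v"
    using orthonormal_completion[OF v] by blast
  define B where "B = W\<^sup>T * A * W"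
  have B: "B \<in> carrier_mat n n" unfolding B_def using A W by auto
  have Bsym: "B\<^sup>T = B" unfolding B_def by (rule congruence_symmetric[OF A W])
  have WW': "W * W\<^sup>T = 1\<^sub>m n" by (rule mat_mult_left_right_inverse[OF _ W WW]) (use W in simp)
  have "similar_mat B A"
    unfolding similar_mat_def using similar_mat_witI[OF WW WW' B_def B A(1)] W by auto
  then have cpB: "char_poly B = char_poly A" by (rule char_poly_similar)
  have "A *\<^sub>v col W 0 = e \<cdot>\<^sub>v col W 0"
    unfolding W0 using mult_mat_vec[OF A(1) v(1)] ev by (simp add: smult_smult_assoc mult.commute)
  then have "col (A * W) 0 = e \<cdot>\<^sub>v col W 0" using A W n by (subst col_mult2[of _ n n _ n]) auto
  then have B0: "B $$ (i, 0) = (if i = 0 then e else 0)" if "i < n" for i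
  proof -
    have "B = W\<^sup>T * (A * W)" unfolding B_def using A W by (intro assoc_mult_mat) auto
    then have "B $$ (i, 0) = col W i \<bullet> col (A * W) 0" using that W A n by simp
    also have "\<dots> = e * (col W i \<bullet> col W 0)"
      unfolding \<open>col (A * W) 0 = e \<cdot>\<^sub>v col W 0\<close> using W n that by simp
    also have "col W i \<bullet> col W 0 = (W\<^sup>T * W) $$ (i, 0)" using W that n by simp
    finally show ?thesis unfolding WW using that n by simp
  qed
  define C where "C = mat k k (\<lambda>(i, j). B $$ (Suc i, Suc j))"
  have C: "C \<in> carrier_mat k k" unfolding C_def by simp
  have Bij: "B $$ (i, j) = B $$ (j, i)" if "i < n" "j < n" for i j
    using arg_cong[OF Bsym, of "\<lambda>M. M $$ (i, j)"] B that by simp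
  have Csym: "C\<^sup>T = C" unfolding C_def by (rule eq_matI) (use Bij n in auto)
  let ?e = "mat 1 1 (\<lambda>_. e)"
  \<comment> \<open>The eigenvector clears the first column below the corner, and symmetry then
    clears the first row.\<close>
  have Bblock: "B = four_block_mat ?e (0\<^sub>m 1 k) (0\<^sub>m k 1) C"
  proof (rule eq_matI)
    fix i j assume "i < dim_row (four_block_mat ?e (0\<^sub>m 1 k) (0\<^sub>m k 1) C)"
      "j < dim_col (four_block_mat ?e (0\<^sub>m 1 k) (0\<^sub>m k 1) C)"
    then have ij: "i < n" "j < n" using n C by auto
    then show "B $$ (i, j) = four_block_mat ?e (0\<^sub>m 1 k) (0\<^sub>m k 1) C $$ (i, j)"
      using B0[of i] B0[of j] Bij[of i j] C n by (cases i; cases j) (auto simp: C_def)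
  qed (use B C n in auto)
  have "char_poly B = char_poly ?e * char_poly C"
    unfolding Bblock by (rule char_poly_four_block_zeros_col) (use C in auto)
  moreover have "char_poly ?e = [:- e, 1:]" by (simp add: char_poly_defs det_def sign_def)
  ultimately have "[:- e, 1:] * char_poly C = [:- e, 1:] * (\<Prod>e\<leftarrow>es. [:- e, 1:])"
    using cpB Cons.prems(3) by simp
  then have "char_poly C = (\<Prod>e\<leftarrow>es. [:- e, 1:])" by (subst (asm) mult_cancel_left) auto
  from Cons.IH[OF C Csym this] obtain V where V: "V \<in> carrier_mat k k" "V\<^sup>T * V = 1\<^sub>m k"
    and VC: "V\<^sup>T * C * V = mat_diag k (\<lambda>i. es ! i)" by blast
  \<comment> \<open>\<open>F\<close> fixes the first basis vector and diagonalises the remaining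
    block, so \<open>W * F\<close> diagonalises \<open>A\<close>.\<close>
  define F where "F = four_block_mat (1\<^sub>m 1) (0\<^sub>m 1 k) (0\<^sub>m k 1) V"
  have F: "F \<in> carrier_mat n n" unfolding F_def using V n by (intro carrier_matI) auto
  have FT: "F\<^sup>T = four_block_mat (1\<^sub>m 1) (0\<^sub>m 1 k) (0\<^sub>m k 1) V\<^sup>T"
    unfolding F_def by (subst transpose_four_block_mat) (use V in auto)
  have FF: "F\<^sup>T * F = 1\<^sub>m n"
    unfolding FT unfolding F_def n
    by (subst mult_four_block_mat) (use V in \<open>auto simp: left_add_zero_mat[of _ k k]\<close>)
  have FB: "F\<^sup>T * B * F = four_block_mat ?e (0\<^sub>m 1 k) (0\<^sub>m k 1) (mat_diag k (\<lambda>i. es ! i))"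
  proof -
    have "F\<^sup>T * B = four_block_mat ?e (0\<^sub>m 1 k) (0\<^sub>m k 1) (V\<^sup>T * C)"
      unfolding FT Bblock
      by (subst mult_four_block_mat) (use V C in \<open>auto simp: left_add_zero_mat[of _ k k]\<close>)
    also have "\<dots> * F = four_block_mat ?e (0\<^sub>m 1 k) (0\<^sub>m k 1) (V\<^sup>T * C * V)"
      unfolding F_def
      by (subst mult_four_block_mat) (use V C in \<open>auto simp: left_add_zero_mat[of _ k k]\<close>)
    finally show ?thesis unfolding VC .
  qed
  have "(W * F)\<^sup>T * (W * F) = F\<^sup>T * (W\<^sup>T * W) * F"
    using W F by (simp add: transpose_mult[of _ n n _ n] assoc_mult_mat[of _ n n _ n _ n])
  also have "\<dots> = 1\<^sub>m n" unfolding WW using F FF by simp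
  finally have 1: "(W * F)\<^sup>T * (W * F) = 1\<^sub>m n" .
  have "(W * F)\<^sup>T * A * (W * F) = F\<^sup>T * B * F"
    unfolding B_def using W F A
    by (simp add: transpose_mult[of _ n n _ n] assoc_mult_mat[of _ n n _ n _ n])
  also have "\<dots> = mat_diag n (\<lambda>i. (e # es) ! i)"
    unfolding FB by (rule eq_matI) (use n in \<open>auto simp: mat_diag_def nth_Cons'\<close>)
  finally show ?case using 1 W F by (intro bexI[of _ "W * F"]) auto
qed

subsection \<open>Comparison of eigenvalues by dimension counting\<close>

text \<open>The columns of \<open>E\<close> are \<open>p\<close> consecutive orthonormal
  eigenvectors after skipping the first \<open>s\<close>. Taking \<open>s = 0\<close> gives a top
  eigenspace and \<open>s + p = n\<close> a bottom one. The \<open>Suc\<close> translates the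
  zero-based offset into the one-based numbering of \<open>eigval\<close>.\<close>

lemma eigenbasis_form:
  fixes A :: "real mat"
  assumes A: "A \<in> carrier_mat n n" "A\<^sup>T = A" and p: "s + p \<le> n"
  shows "\<exists>E \<in> carrier_mat n p. \<forall>x \<in> carrier_vec p.
    (E *\<^sub>v x) \<bullet> (E *\<^sub>v x) = x \<bullet> x \<and>
    (E *\<^sub>v x) \<bullet> (A *\<^sub>v (E *\<^sub>v x)) = (\<Sum>i<p. eigval A (Suc (s + i)) * (x $ i)\<^sup>2)"
proof -
  obtain U where U: "U \<in> carrier_mat n n" and UU: "U\<^sup>T * U = 1\<^sub>m n"
    and UA: "U\<^sup>T * A * U = mat_diag n (\<lambda>i. eigvals A ! i)"
    using spectral_decomposition[OF A eigvals_char_poly[OF A]] by blast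
  \<comment> \<open>\<open>U * G\<close> selects the columns \<open>s\<close> to
    \<open>s + p - 1\<close> of \<open>U\<close>.\<close>
  define G where "G = mat n p (\<lambda>(r, c). if r = s + c then 1 else (0::real))"
  have G: "G \<in> carrier_mat n p" unfolding G_def by simp
  have Gx: "(G *\<^sub>v x) $ i = (if s \<le> i \<and> i < s + p then x $ (i - s) else 0)"
    if x: "x \<in> carrier_vec p" and i: "i < n" for x i
  proof -
    have "(G *\<^sub>v x) $ i = (\<Sum>c<p. if i = s + c then x $ c else 0)"
      using x i unfolding G_def by (auto simp: scalar_prod_def atLeast0LessThan intro!: sum.cong)
    also have "\<dots> = (if s \<le> i \<and> i < s + p then x $ (i - s) else 0)"
    proof (cases "s \<le> i")
      case True
      then have "(\<Sum>c<p. if i = s + c then x $ c else 0) = (\<Sum>c<p. if i - s = c then x $ c else 0)"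
        by (intro sum.cong) auto
      then show ?thesis using True by auto
    qed auto
    finally show ?thesis .
  qed
  have sumG: "(\<Sum>i<n. f i * ((G *\<^sub>v x) $ i)\<^sup>2) = (\<Sum>i<p. f (s + i) * (x $ i)\<^sup>2)"
    if x: "x \<in> carrier_vec p" for x and f :: "nat \<Rightarrow> real"
  proof -
    have "(\<Sum>i<n. f i * ((G *\<^sub>v x) $ i)\<^sup>2) = (\<Sum>i\<in>{s..<s+p}. f i * ((G *\<^sub>v x) $ i)\<^sup>2)"
      using p Gx[OF x] by (intro sum.mono_neutral_right) auto
    also have "\<dots> = (\<Sum>i\<in>{s..<s+p}. f i * (x $ (i - s))\<^sup>2)"
      using p Gx[OF x] by (intro sum.cong) auto
    also have "\<dots> = (\<Sum>i<p. f (s + i) * (x $ i)\<^sup>2)"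
      by (rule sum.reindex_bij_witness[of _ "\<lambda>i. s + i" "\<lambda>i. i - s"]) auto
    finally show ?thesis .
  qed
  have "(U * G *\<^sub>v x) \<bullet> (U * G *\<^sub>v x) = x \<bullet> x \<and>
    (U * G *\<^sub>v x) \<bullet> (A *\<^sub>v (U * G *\<^sub>v x)) = (\<Sum>i<p. eigval A (Suc (s + i)) * (x $ i)\<^sup>2)"
    if x: "x \<in> carrier_vec p" for x
  proof -
    define y where "y = G *\<^sub>v x"
    have y: "y \<in> carrier_vec n" unfolding y_def using G x by simp
    have Uy: "U * G *\<^sub>v x = U *\<^sub>v y" unfolding y_def using U G x by simp
    have "(U *\<^sub>v y) \<bullet> (U *\<^sub>v y) = (U\<^sup>T *\<^sub>v (U *\<^sub>v y)) \<bullet> y"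
      by (rule scalar_prod_adjoint) (use U y in auto)
    also have "U\<^sup>T *\<^sub>v (U *\<^sub>v y) = U\<^sup>T * U *\<^sub>v y" using U y by simp
    also have "\<dots> = y" unfolding UU using y by simp
    also have "y \<bullet> y = (\<Sum>i<n. 1 * (y $ i)\<^sup>2)"
      using y by (simp add: scalar_prod_def power2_eq_square atLeast0LessThan)
    also have "\<dots> = (\<Sum>i<p. 1 * (x $ i)\<^sup>2)" unfolding y_def by (rule sumG[OF x])
    also have "\<dots> = x \<bullet> x"
      using x by (simp add: scalar_prod_def power2_eq_square atLeast0LessThan)
    finally have 1: "(U *\<^sub>v y) \<bullet> (U *\<^sub>v y) = x \<bullet> x" .
    have "(U *\<^sub>v y) \<bullet> (A *\<^sub>v (U *\<^sub>v y)) = (A *\<^sub>v (U *\<^sub>v y)) \<bullet> (U *\<^sub>v y)"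
      by (rule comm_scalar_prod[of _ n]) (use A U y in auto)
    also have "\<dots> = (U\<^sup>T *\<^sub>v (A *\<^sub>v (U *\<^sub>v y))) \<bullet> y"
      by (rule scalar_prod_adjoint) (use A U y in auto)
    also have "U\<^sup>T *\<^sub>v (A *\<^sub>v (U *\<^sub>v y)) = U\<^sup>T * A * U *\<^sub>v y"
      using A U y by (simp add: assoc_mult_mat_vec[of _ n n _ n])
    also have "\<dots> = vec n (\<lambda>i. eigvals A ! i * y $ i)"
      unfolding UA
      by (rule eq_vecI) (use y in \<open>auto simp: mat_diag_def scalar_prod_def if_distrib if_distribR cong: if_cong\<close>)
    also have "\<dots> \<bullet> y = (\<Sum>i<n. eigvals A ! i * (y $ i)\<^sup>2)"
      using y by (simp add: scalar_prod_def power2_eq_square atLeast0LessThan mult.assoc)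
    also have "\<dots> = (\<Sum>i<p. eigvals A ! (s + i) * (x $ i)\<^sup>2)" unfolding y_def by (rule sumG[OF x])
    finally show ?thesis using 1 unfolding Uy by (simp add: eigval_def)
  qed
  then show ?thesis using U G by (intro bexI[of _ "U * G"]) auto
qed

text \<open>Dimension counting phrased through determinants: \<open>[P, -R]\<close> has more columns
  than rows, so padding it with zero rows to a square matrix makes it singular. A kernel vector
  splits into \<open>a\<close> and \<open>b\<close>.\<close>

lemma wide_system_nontrivial:
  fixes P R :: "'a :: field mat"
  assumes P: "P \<in> carrier_mat N p" and R: "R \<in> carrier_mat N r" and less: "N < p + r"
  shows "\<exists>a \<in> carrier_vec p. \<exists>b \<in> carrier_vec r. (a \<noteq> 0\<^sub>v p \<or> b \<noteq> 0\<^sub>v r) \<and> P *\<^sub>v a = R *\<^sub>v b"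
proof -
  define k where "k = p + r - N"
  have k: "N + k = p + r" "0 < k" using less unfolding k_def by auto
  define M where "M = four_block_mat P (- R) (0\<^sub>m k p) (0\<^sub>m k r)"
  have M: "M \<in> carrier_mat (p + r) (p + r)" unfolding M_def using P R k by auto
  \<comment> \<open>As \<open>k\<close> is positive, the last row of \<open>M\<close> is one of the
    padded zero rows; hence the transpose annihilates the last unit vector.\<close>
  have "M\<^sup>T *\<^sub>v unit_vec (p + r) (p + r - 1) = 0\<^sub>v (p + r)"
  proof (rule eq_vecI)
    fix i assume "i < dim_vec (0\<^sub>v (p + r) :: 'a vec)"
    then have i: "i < p + r" by simp
    have "(M\<^sup>T *\<^sub>v unit_vec (p + r) (p + r - 1)) $ i = M $$ (p + r - 1, i)"
      using M i by (simp add: scalar_prod_right_unit[of _ "p + r"])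
    also have "\<dots> = 0" using P R k i unfolding M_def by auto
    finally show "(M\<^sup>T *\<^sub>v unit_vec (p + r) (p + r - 1)) $ i = 0\<^sub>v (p + r) $ i" using i by simp
  qed (use M in auto)
  moreover have "unit_vec (p + r) (p + r - 1) \<noteq> (0\<^sub>v (p + r) :: 'a vec)"
  proof
    assume "unit_vec (p + r) (p + r - 1) = (0\<^sub>v (p + r) :: 'a vec)"
    from arg_cong[OF this, of "\<lambda>v. v $ (p + r - 1)"] less show False by simp
  qed
  ultimately have "det M\<^sup>T = 0"
    using det_0_iff_vec_prod_zero_field[of "M\<^sup>T" "p + r"] M transpose_carrier_mat[of M] unit_vec_carrier by blast
  then have "det M = 0" using det_transpose[OF M] by simp
  then obtain z where z: "z \<in> carrier_vec (p + r)" "z \<noteq> 0\<^sub>v (p + r)" "M *\<^sub>v z = 0\<^sub>v (p + r)"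
    using det_0_iff_vec_prod_zero_field[OF M] by auto
  define a b where "a = vec_first z p" and "b = vec_last z r"
  have ab: "a \<in> carrier_vec p" "b \<in> carrier_vec r" "z = a @\<^sub>v b"
    unfolding a_def b_def using z by auto
  have "M *\<^sub>v z = (P *\<^sub>v a + - R *\<^sub>v b) @\<^sub>v (0\<^sub>m k p *\<^sub>v a + 0\<^sub>m k r *\<^sub>v b)"
    unfolding M_def ab(3) by (rule four_block_mat_mult_vec) (use P R ab in auto)
  moreover have "0\<^sub>v (p + r) = 0\<^sub>v N @\<^sub>v (0\<^sub>v k :: 'a vec)" unfolding k(1)[symmetric] by auto
  ultimately have Mz: "(P *\<^sub>v a + - R *\<^sub>v b) @\<^sub>v (0\<^sub>m k p *\<^sub>v a + 0\<^sub>m k r *\<^sub>v b) = 0\<^sub>v N @\<^sub>v 0\<^sub>v k"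
    using z(3) by simp
  then have 0: "P *\<^sub>v a + - R *\<^sub>v b = 0\<^sub>v N"
    by (subst (asm) append_vec_eq[of _ N]) (use P R ab in auto)
  have "P *\<^sub>v a = R *\<^sub>v b"
  proof (rule eq_vecI)
    fix i assume "i < dim_vec (R *\<^sub>v b)"
    with arg_cong[OF 0, of "\<lambda>v. v $ i"] P R ab show "(P *\<^sub>v a) $ i = (R *\<^sub>v b) $ i" by simp
  qed (use P R in auto)
  moreover have "a \<noteq> 0\<^sub>v p \<or> b \<noteq> 0\<^sub>v r" using z(2) ab by auto
  ultimately show ?thesis using ab by blast
qed

text \<open>The span of the top \<open>i\<close> eigenvectors of \<open>A\<close> and that of the bottom \<open>k + 1 - j\<close> eigenvectors
  of \<open>B\<close> have total dimension exceeding \<open>N\<close>, so their images under \<open>X\<close> and \<open>Y\<close> share a vector.\<close>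

lemma eigval_le_eigval:
  fixes A B X Y :: "real mat"
  assumes A: "A \<in> carrier_mat n n" "A\<^sup>T = A" and B: "B \<in> carrier_mat k k" "B\<^sup>T = B"
    and X: "X \<in> carrier_mat N n" and Y: "Y \<in> carrier_mat N k"
    and i: "1 \<le> i" "i \<le> n" and j: "1 \<le> j" "j \<le> k" and dim: "N + j \<le> i + k"
    and le: "\<And>x y. x \<in> carrier_vec n \<Longrightarrow> y \<in> carrier_vec k \<Longrightarrow> X *\<^sub>v x = Y *\<^sub>v y \<Longrightarrow>
      x \<bullet> x = y \<bullet> y \<and> x \<bullet> (A *\<^sub>v x) \<le> y \<bullet> (B *\<^sub>v y)"
  shows "eigval A i \<le> eigval B j"
proof -
  define l where "l = k + 1 - j"
  have l: "(j - 1) + l = k" "N < i + l" using j dim unfolding l_def by auto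
  obtain E where E: "E \<in> carrier_mat n i"
    and nE: "\<And>a. a \<in> carrier_vec i \<Longrightarrow> (E *\<^sub>v a) \<bullet> (E *\<^sub>v a) = a \<bullet> a"
    and fE: "\<And>a. a \<in> carrier_vec i \<Longrightarrow> (E *\<^sub>v a) \<bullet> (A *\<^sub>v (E *\<^sub>v a)) =
      (\<Sum>r<i. eigval A (Suc r) * (a $ r)\<^sup>2)"
    using eigenbasis_form[OF A, of 0 i] i by auto
  obtain F where F: "F \<in> carrier_mat k l"
    and nF: "\<And>b. b \<in> carrier_vec l \<Longrightarrow> (F *\<^sub>v b) \<bullet> (F *\<^sub>v b) = b \<bullet> b"
    and fF: "\<And>b. b \<in> carrier_vec l \<Longrightarrow> (F *\<^sub>v b) \<bullet> (B *\<^sub>v (F *\<^sub>v b)) =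
      (\<Sum>r<l. eigval B (Suc (j - 1 + r)) * (b $ r)\<^sup>2)"
    using eigenbasis_form[OF B, of "j - 1" l] l by auto
  obtain a b where a: "a \<in> carrier_vec i" and b: "b \<in> carrier_vec l"
    and nz: "a \<noteq> 0\<^sub>v i \<or> b \<noteq> 0\<^sub>v l" and eq: "X * E *\<^sub>v a = Y * F *\<^sub>v b"
    using wide_system_nontrivial[of "X * E" N i "Y * F" l] X Y E F l by auto
  let ?x = "E *\<^sub>v a" and ?y = "F *\<^sub>v b"
  have "X *\<^sub>v ?x = Y *\<^sub>v ?y" using eq X Y E F a b by simp
  then have *: "a \<bullet> a = b \<bullet> b" "?x \<bullet> (A *\<^sub>v ?x) \<le> ?y \<bullet> (B *\<^sub>v ?y)"
    using le[of ?x ?y] nE[OF a] nF[OF b] E F a b by auto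
  \<comment> \<open>Only one of \<open>a\<close> and \<open>b\<close> is known to be nonzero, but
    they have equal norms, so both are.\<close>
  have pos: "b \<bullet> b > 0" using nz scalar_prod_self_pos[OF a] scalar_prod_self_pos[OF b] *(1) by auto
  have sq: "v \<bullet> v = (\<Sum>r<q. (v $ r)\<^sup>2)" if "v \<in> carrier_vec q" for v :: "real vec" and q
    using that by (simp add: scalar_prod_def power2_eq_square atLeast0LessThan)
  \<comment> \<open>\<open>eigval A i\<close> is the smallest weight among the top \<open>i\<close>,
    and below \<open>eigval B j\<close> is the largest weight among the bottom \<open>l\<close>; the
    two forms are squeezed in between.\<close>
  have "eigval A i * (a \<bullet> a) \<le> ?x \<bullet> (A *\<^sub>v ?x)"
    unfolding fE[OF a] sq[OF a] sum_distrib_left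
    using i by (intro sum_mono mult_right_mono eigval_mono[OF A]) auto
  also note *(2)
  also have "?y \<bullet> (B *\<^sub>v ?y) \<le> eigval B j * (b \<bullet> b)"
    unfolding fF[OF b] sq[OF b] sum_distrib_left
    using j l by (intro sum_mono mult_right_mono eigval_mono[OF B]) auto
  finally show ?thesis using pos *(1) by simp
qed

text \<open>With \<open>s = 0\<close> and \<open>p = n\<close> the eigenbasis matrix preserves
  norms, so it has trivial kernel and is invertible. Every \<open>x\<close> therefore has
  coordinates in which the form is a sum of squares weighted by eigenvalues.\<close>

lemma eigval_le_rayleigh:
  fixes A :: "real mat"
  assumes A: "A \<in> carrier_mat n n" "A\<^sup>T = A" and x: "x \<in> carrier_vec n"
  shows "eigval A n * (x \<bullet> x) \<le> x \<bullet> (A *\<^sub>v x)"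
proof -
  obtain E where E: "E \<in> carrier_mat n n"
    and nE: "\<And>a. a \<in> carrier_vec n \<Longrightarrow> (E *\<^sub>v a) \<bullet> (E *\<^sub>v a) = a \<bullet> a"
    and fE: "\<And>a. a \<in> carrier_vec n \<Longrightarrow> (E *\<^sub>v a) \<bullet> (A *\<^sub>v (E *\<^sub>v a)) =
      (\<Sum>r<n. eigval A (Suc r) * (a $ r)\<^sup>2)"
    using eigenbasis_form[OF A, of 0 n] by auto
  have "det E \<noteq> 0"
  proof
    assume "det E = 0"
    then obtain v where v: "v \<in> carrier_vec n" "v \<noteq> 0\<^sub>v n" "E *\<^sub>v v = 0\<^sub>v n"
      using det_0_iff_vec_prod_zero_field[OF E] by auto
    then show False using nE[OF v(1)] scalar_prod_self_pos[OF v(1,2)] by simp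
  qed
  then obtain a where a: "a \<in> carrier_vec n" "x = E *\<^sub>v a"
  proof -
    obtain E' where E': "E' \<in> carrier_mat n n" "E * E' = 1\<^sub>m n"
      using det_non_zero_imp_unit[OF E \<open>det E \<noteq> 0\<close>, of "()"]
      unfolding Units_def ring_mat_def by auto
    have "x = E *\<^sub>v (E' *\<^sub>v x)"
      using assoc_mult_mat_vec[OF E E'(1) x] E'(2) x by simp
    then show ?thesis using that[of "E' *\<^sub>v x"] E' x by simp
  qed
  have "eigval A n * (x \<bullet> x) = (\<Sum>r<n. eigval A n * (a $ r)\<^sup>2)"
    unfolding a(2) nE[OF a(1)] using a(1)
    by (simp add: scalar_prod_def power2_eq_square atLeast0LessThan sum_distrib_left)
  also have "\<dots> \<le> (\<Sum>r<n. eigval A (Suc r) * (a $ r)\<^sup>2)"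
    by (intro sum_mono mult_right_mono eigval_mono[OF A]) auto
  also have "\<dots> = x \<bullet> (A *\<^sub>v x)" unfolding a(2) fE[OF a(1)] ..
  finally show ?thesis .
qed

text \<open>The bound is tested at an eigenvector. In the spectral floor, \<open>c\<close> comes
  from a different matrix than \<open>A\<close>.\<close>

lemma eigenvalue_ge:
  fixes A :: "real mat"
  assumes A: "A \<in> carrier_mat n n" and e: "eigenvalue A e"
    and ge: "\<And>x. x \<in> carrier_vec n \<Longrightarrow> c * (x \<bullet> x) \<le> x \<bullet> (A *\<^sub>v x)"
  shows "c \<le> e"
proof -
  obtain v where v: "v \<in> carrier_vec n" "v \<noteq> 0\<^sub>v n" "A *\<^sub>v v = e \<cdot>\<^sub>v v"
    using e A unfolding eigenvalue_def eigenvector_def by auto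
  have "c * (v \<bullet> v) \<le> e * (v \<bullet> v)" using ge[OF v(1)] v by simp
  then show ?thesis using scalar_prod_self_pos[OF v(1,2)] by simp
qed

text \<open>One direction tests the form at an eigenvector, the other is the Rayleigh bound. For
  \<open>n = 0\<close> the term \<open>eigval A n\<close> would read an empty list.\<close>

lemma pos_def_iff_eigval:
  assumes A: "A \<in> carrier_mat n n" "A\<^sup>T = A" and n: "1 \<le> n"
  shows "pos_def A \<longleftrightarrow> 0 < eigval A n"
proof
  assume pd: "pos_def A"
  obtain v where v: "v \<in> carrier_vec n" "v \<noteq> 0\<^sub>v n" "A *\<^sub>v v = eigval A n \<cdot>\<^sub>v v"
    using eigenvalue_eigval[OF A n order_refl] A unfolding eigenvalue_def eigenvector_def by auto
  have "0 < v \<bullet> (A *\<^sub>v v)" using pd A v unfolding pos_def_def by auto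
  then have "0 < eigval A n * (v \<bullet> v)" using v by simp
  then show "0 < eigval A n" using scalar_prod_self_pos[OF v(1,2)] by (simp add: zero_less_mult_iff)
next
  assume p: "0 < eigval A n"
  have "0 < x \<bullet> (A *\<^sub>v x)" if x: "x \<in> carrier_vec n" "x \<noteq> 0\<^sub>v n" for x
    using mult_pos_pos[OF p scalar_prod_self_pos[OF x]] eigval_le_rayleigh[OF A x(1)] by linarith
  then show "pos_def A" using A unfolding pos_def_def by auto
qed

subsection \<open>Interlacing\<close>

text \<open>The form of the compression at \<open>y\<close> is the form of \<open>A\<close> at
  \<open>V y\<close>, and \<open>V\<close> preserves norms. Both bounds are the comparison principle
  in ambient dimension \<open>n\<close>, with \<open>V\<close> and the identity as the two maps in
  either order; the shift \<open>n - k\<close> is the lost dimension.\<close>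

lemma cauchy_interlacing:
  fixes A V :: "real mat"
  assumes A: "A \<in> carrier_mat n n" "A\<^sup>T = A" and V: "V \<in> carrier_mat n k" "V\<^sup>T * V = 1\<^sub>m k"
    and kn: "k \<le> n" and i: "1 \<le> i" "i \<le> k"
  shows "eigval (V\<^sup>T * A * V) i \<le> eigval A i"
    and "eigval A (i + (n - k)) \<le> eigval (V\<^sup>T * A * V) i"
proof -
  let ?D = "V\<^sup>T * A * V"
  have D: "?D \<in> carrier_mat k k" "?D\<^sup>T = ?D"
    using A V congruence_symmetric[OF A V(1)] by auto
  have form: "y \<bullet> (?D *\<^sub>v y) = (V *\<^sub>v y) \<bullet> (A *\<^sub>v (V *\<^sub>v y))" if y: "y \<in> carrier_vec k" for y
  proof -
    have "?D *\<^sub>v y = V\<^sup>T *\<^sub>v (A *\<^sub>v (V *\<^sub>v y))"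
      using A V y by (simp add: assoc_mult_mat_vec[of _ k n _ k] assoc_mult_mat_vec[of _ k n _ n])
    then show ?thesis
      using scalar_prod_adjoint[of "V\<^sup>T" k n y "A *\<^sub>v (V *\<^sub>v y)"] A V y by simp
  qed
  have norm: "(V *\<^sub>v y) \<bullet> (V *\<^sub>v y) = y \<bullet> y" if y: "y \<in> carrier_vec k" for y
    using scalar_prod_adjoint[of V n k "V *\<^sub>v y" y] assoc_mult_mat_vec[of "V\<^sup>T" k n V k y] V y
    by simp
  show "eigval ?D i \<le> eigval A i"
    by (rule eigval_le_eigval[OF D A V(1) one_carrier_mat])
      (use i kn form norm in auto)
  show "eigval A (i + (n - k)) \<le> eigval ?D i"
    by (rule eigval_le_eigval[OF A D one_carrier_mat V(1)])
      (use i kn form norm in auto)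
qed

section \<open>Rank-one corrections\<close>

lemma outer_prod_carrier: "outer_prod x y \<in> carrier_mat (dim_vec x) (dim_vec y)"
  unfolding outer_prod_def by simp

lemma rank_one_form:
  fixes H :: "real mat"
  assumes H: "H \<in> carrier_mat n n" and u: "u \<in> carrier_vec n" and x: "x \<in> carrier_vec n"
  shows "x \<bullet> ((H - \<gamma> \<cdot>\<^sub>m outer_prod u u) *\<^sub>v x) = x \<bullet> (H *\<^sub>v x) - \<gamma> * (u \<bullet> x)\<^sup>2"
proof -
  let ?O = "outer_prod u u"
  have O: "?O \<in> carrier_mat n n" using outer_prod_carrier[of u u] u by simp
  have Ox: "?O *\<^sub>v x = (u \<bullet> x) \<cdot>\<^sub>v u"
    by (rule eq_vecI)
      (use u x in \<open>auto simp: outer_prod_def scalar_prod_def sum_distrib_left mult_ac\<close>)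
  have "(H - \<gamma> \<cdot>\<^sub>m ?O) *\<^sub>v x = H *\<^sub>v x - (\<gamma> \<cdot>\<^sub>m ?O) *\<^sub>v x"
    by (rule minus_mult_distrib_mat_vec) (use H O x in auto)
  also have "(\<gamma> \<cdot>\<^sub>m ?O) *\<^sub>v x = \<gamma> \<cdot>\<^sub>v ((u \<bullet> x) \<cdot>\<^sub>v u)"
    unfolding Ox[symmetric] by (rule eq_vecI) (use O x in auto)
  finally show ?thesis
    using H u x comm_scalar_prod[OF x u]
    by (simp add: scalar_prod_minus_distrib[of _ n] power2_eq_square)
qed

lemma rank_one_update_symmetric:
  assumes H: "H \<in> carrier_mat n n" "H\<^sup>T = H" and u: "u \<in> carrier_vec n"
  shows "(H - \<gamma> \<cdot>\<^sub>m outer_prod u u)\<^sup>T = H - \<gamma> \<cdot>\<^sub>m outer_prod u u"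
proof -
  have "H $$ (i, l) = H $$ (l, i)" if "i < n" "l < n" for i l
    using arg_cong[OF H(2), of "\<lambda>M. M $$ (i, l)"] H(1) that by simp
  then show ?thesis by (intro eq_matI) (use H u in \<open>auto simp: outer_prod_def\<close>)
qed

lemma rank_one_interlacing:
  fixes H :: "real mat"
  assumes H: "H \<in> carrier_mat n n" "H\<^sup>T = H" and u: "u \<in> carrier_vec n" and \<gamma>: "0 \<le> \<gamma>"
    and j: "1 \<le> j" "j \<le> n"
  shows "eigval (H - \<gamma> \<cdot>\<^sub>m outer_prod u u) j \<le> eigval H j"
    and "j < n \<Longrightarrow> eigval H (j + 1) \<le> eigval (H - \<gamma> \<cdot>\<^sub>m outer_prod u u) j"
proof -
  let ?S = "H - \<gamma> \<cdot>\<^sub>m outer_prod u u"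
  have S: "?S \<in> carrier_mat n n" using H u outer_prod_carrier[of u u] by auto
  have Ssym: "?S\<^sup>T = ?S" by (rule rank_one_update_symmetric[OF H u])
  note form = rank_one_form[OF H(1) u]
  \<comment> \<open>For nonnegative \<gamma> the correction only lowers the form, so both maps can
    be the identity.\<close>
  show "eigval ?S j \<le> eigval H j"
    by (rule eigval_le_eigval[OF S Ssym H one_carrier_mat one_carrier_mat]) (use j \<gamma> form in auto)
  assume jn: "j < n"
  \<comment> \<open>Stacking the row \<open>u\<close> under the identity makes \<open>X x = Y y\<close> force \<open>x = y\<close> and \<open>u \<bullet> x = 0\<close>,
    where both forms agree; this costs one dimension.\<close>
  define X where "X = mat (Suc n) n (\<lambda>(i, l). if i < n then (if i = l then 1 else 0) else u $ l)"
  define Y where "Y = mat (Suc n) n (\<lambda>(i, l). if i = l then 1 else (0::real))"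
  have XY: "X \<in> carrier_mat (Suc n) n" "Y \<in> carrier_mat (Suc n) n"
    unfolding X_def Y_def by auto
  have X1: "(X *\<^sub>v x) $ i = x $ i" if "x \<in> carrier_vec n" "i < n" for x i
  proof -
    have "(X *\<^sub>v x) $ i = (\<Sum>l<n. (if i = l then 1 else 0) * x $ l)"
      using that unfolding X_def
      by (simp add: scalar_prod_def atLeast0LessThan)
    also have "\<dots> = (\<Sum>l<n. if i = l then x $ l else 0)" by (rule sum.cong) auto
    finally show ?thesis using that by simp
  qed
  have X2: "(X *\<^sub>v x) $ n = u \<bullet> x" if "x \<in> carrier_vec n" for x
    using that u unfolding X_def by (auto simp: scalar_prod_def intro!: sum.cong)
  have Y1: "(Y *\<^sub>v x) $ i = x $ i" if "x \<in> carrier_vec n" "i < n" for x i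
  proof -
    have "(Y *\<^sub>v x) $ i = (\<Sum>l<n. (if i = l then 1 else 0) * x $ l)"
      using that unfolding Y_def
      by (simp add: scalar_prod_def atLeast0LessThan)
    also have "\<dots> = (\<Sum>l<n. if i = l then x $ l else 0)" by (rule sum.cong) auto
    finally show ?thesis using that by simp
  qed
  have Y2: "(Y *\<^sub>v x) $ n = 0" if "x \<in> carrier_vec n" for x
    using that unfolding Y_def by (auto simp: scalar_prod_def intro!: sum.neutral)
  have kernel: "x = y \<and> u \<bullet> x = 0"
    if x: "x \<in> carrier_vec n" and y: "y \<in> carrier_vec n" and eq: "X *\<^sub>v x = Y *\<^sub>v y" for x y
  proof
    show "x = y" by (rule eq_vecI) (use x y X1[OF x] Y1[OF y] eq in auto)
    show "u \<bullet> x = 0" using X2[OF x] Y2[OF y] eq by simp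
  qed
  show "eigval H (j + 1) \<le> eigval ?S j"
  \<comment> \<open>The dimension condition \<open>Suc n + j \<le> (j + 1) + n\<close> holds with
    equality: the index shift by one pays for the extra row.\<close>
  proof (rule eigval_le_eigval[OF H S Ssym XY])
    fix x y assume *: "x \<in> carrier_vec n" "y \<in> carrier_vec n" "X *\<^sub>v x = Y *\<^sub>v y"
    show "x \<bullet> x = y \<bullet> y \<and> x \<bullet> (H *\<^sub>v x) \<le> y \<bullet> (?S *\<^sub>v y)"
      using kernel[OF *] form[OF *(2)] by auto
  qed (use j jn in auto)
qed

subsection \<open>Inverses and Schur complements\<close>

text \<open>A right inverse of a square matrix is two-sided, so \<open>mat_inverse\<close> returns a
  value here, and uniqueness of inverses identifies it with \<open>B\<close>.\<close>

lemma minv_eqI: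
  assumes A: "A \<in> carrier_mat n n" and B: "B \<in> carrier_mat n n" and AB: "A * B = 1\<^sub>m n"
  shows "minv A = B"
proof -
  have BA: "B * A = 1\<^sub>m n" by (rule mat_mult_left_right_inverse[OF A B AB])
  have "A \<in> Units (ring_mat TYPE(real) n ())"
    unfolding Units_def ring_mat_def using A B AB BA by auto
  then obtain C where C: "mat_inverse A = Some C"
    using mat_inverse(1)[OF A, of "()"] by (cases "mat_inverse A") auto
  with mat_inverse(2)[OF A] have "C * A = 1\<^sub>m n" "C \<in> carrier_mat n n" by auto
  then have "C = B"
    using assoc_mult_mat[of C n n A n B n] A B AB by simp
  then show ?thesis unfolding minv_def C by simp
qed

lemma pos_def_minv:
  assumes A: "A \<in> carrier_mat n n" "pos_def A"
  shows "minv A \<in> carrier_mat n n" "A * minv A = 1\<^sub>m n" "minv A * A = 1\<^sub>m n"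
    "(minv A)\<^sup>T = minv A"
proof -
  have "det A \<noteq> 0"
  proof
    assume "det A = 0"
    then obtain v where v: "v \<in> carrier_vec n" "v \<noteq> 0\<^sub>v n" "A *\<^sub>v v = 0\<^sub>v n"
      using det_0_iff_vec_prod_zero_field[OF A(1)] by auto
    then have "0 < v \<bullet> (A *\<^sub>v v)" using A unfolding pos_def_def by auto
    then show False using v by simp
  qed
  then obtain B where B: "B \<in> carrier_mat n n" "A * B = 1\<^sub>m n"
    using det_non_zero_imp_unit[OF A(1), of "()"] unfolding Units_def ring_mat_def by auto
  have eq: "minv A = B" by (rule minv_eqI[OF A(1) B])
  show "minv A \<in> carrier_mat n n" "A * minv A = 1\<^sub>m n" using B eq by auto
  show BA: "minv A * A = 1\<^sub>m n"
    unfolding eq by (rule mat_mult_left_right_inverse[OF A(1) B])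
  have "A * B\<^sup>T = (B * A)\<^sup>T"
    using transpose_mult[OF B(1) A(1)] A(2) unfolding pos_def_def by simp
  then have "minv A = B\<^sup>T" using minv_eqI[OF A(1), of "B\<^sup>T"] B BA eq by simp
  then show "(minv A)\<^sup>T = minv A" using eq by simp
qed

text \<open>Since \<open>y\<close> solves \<open>A y = e_i\<close>, its form and its coordinate
  \<open>i\<close> both equal the diagonal entry of the inverse. For \<open>T\<close> this gives the
  sign of \<gamma>; for \<open>Tp\<close> it supplies the test vector for the well-posedness
  condition.\<close>

lemma minv_diag_form:
  assumes A: "A \<in> carrier_mat n n" "pos_def A" and i: "i < n"
  defines "y \<equiv> minv A *\<^sub>v unit_vec n i"
  shows "y \<in> carrier_vec n" "y $ i = minv A $$ (i, i)" "y \<bullet> (A *\<^sub>v y) = minv A $$ (i, i)"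
    "0 < minv A $$ (i, i)"
proof -
  note B = pos_def_minv[OF A]
  show y: "y \<in> carrier_vec n" unfolding y_def using B(1) by simp
  show yi: "y $ i = minv A $$ (i, i)"
    unfolding y_def using B(1) i by (simp add: scalar_prod_right_unit[of _ n])
  have Ay: "A *\<^sub>v y = unit_vec n i"
    unfolding y_def using assoc_mult_mat_vec[OF A(1) B(1), of "unit_vec n i"] B(2) by simp
  then show yAy: "y \<bullet> (A *\<^sub>v y) = minv A $$ (i, i)"
    using y yi i by (simp add: scalar_prod_right_unit[of _ n])
  have "y \<noteq> 0\<^sub>v n"
  proof
    assume "y = 0\<^sub>v n"
    then have "unit_vec n i = A *\<^sub>v 0\<^sub>v n" using Ay by simp
    also have "\<dots> = 0\<^sub>v n" using A(1) by (intro eq_vecI) auto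
    finally have "unit_vec n i = (0\<^sub>v n :: real vec)" .
    from arg_cong[OF this, of "\<lambda>v. v $ i"] i show False by simp
  qed
  then show "0 < minv A $$ (i, i)" using A y yAy unfolding pos_def_def by auto
qed

text \<open>By Cauchy interlacing, the smallest eigenvalue of a compression is at least that of
  \<open>A\<close>.\<close>

lemma pos_def_congruence:
  assumes A: "A \<in> carrier_mat n n" "pos_def A" and V: "V \<in> carrier_mat n k" "V\<^sup>T * V = 1\<^sub>m k"
    and k: "1 \<le> k" "k \<le> n"
  shows "pos_def (V\<^sup>T * A * V)"
proof -
  have sym: "A\<^sup>T = A" using A(2) unfolding pos_def_def by blast
  have D: "V\<^sup>T * A * V \<in> carrier_mat k k" using A V by auto
  have "0 < eigval A n" using pos_def_iff_eigval[OF A(1) sym] A(2) k by simp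
  also have "eigval A n \<le> eigval (V\<^sup>T * A * V) k"
    using cauchy_interlacing(2)[OF A(1) sym V k(2) k(1) order_refl] k by simp
  finally show ?thesis
    using pos_def_iff_eigval[OF D congruence_symmetric[OF A(1) sym V(1)] k(1)] by simp
qed

text \<open>An eigenvector of \<open>R\<close> for \<open>e\<close> is an eigenvector of
  \<open>S\<close> for \<open>1 / e\<close>; the extreme eigenvalues of \<open>S\<close> then bound
  \<open>1 / e\<close>, and positivity allows taking reciprocals.\<close>

lemma eigenvalue_inverse_bounds:
  fixes S R :: "real mat"
  assumes S: "S \<in> carrier_mat n n" "S\<^sup>T = S" and R: "R \<in> carrier_mat n n" "S * R = 1\<^sub>m n"
    and pos: "0 < eigval S n" and e: "eigenvalue R e"
  shows "1 / eigval S 1 \<le> e" "e \<le> 1 / eigval S n"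
proof -
  obtain v where v: "v \<in> carrier_vec n" "v \<noteq> 0\<^sub>v n" "R *\<^sub>v v = e \<cdot>\<^sub>v v"
    using e R unfolding eigenvalue_def eigenvector_def by auto
  have "v = S *\<^sub>v (R *\<^sub>v v)" using assoc_mult_mat_vec[OF S(1) R(1) v(1)] R(2) v(1) by simp
  also have "\<dots> = e \<cdot>\<^sub>v (S *\<^sub>v v)" unfolding v(3) by (rule mult_mat_vec[OF S(1) v(1)])
  finally have veq: "v = e \<cdot>\<^sub>v (S *\<^sub>v v)" .
  have e0: "e \<noteq> 0"
  proof
    assume "e = 0"
    then have "v = 0\<^sub>v n" using arg_cong[OF veq, of "\<lambda>w. w $ i" for i] S v(1) by (intro eq_vecI) auto
    with v(2) show False ..
  qed
  have "(1 / e) \<cdot>\<^sub>v v = (1 / e) \<cdot>\<^sub>v (e \<cdot>\<^sub>v (S *\<^sub>v v))" using veq by simp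
  then have "S *\<^sub>v v = (1 / e) \<cdot>\<^sub>v v" using e0 by (simp add: smult_smult_assoc)
  then have "eigenvalue S (1 / e)" using S v unfolding eigenvalue_def eigenvector_def by auto
  note b = eigenvalue_bounds[OF S this]
  have "0 < 1 / e" using pos b(1) by linarith
  then have ep: "0 < e" by simp
  have l1: "0 < eigval S 1" using pos b by linarith
  show "1 / eigval S 1 \<le> e" using b(2) ep l1 by (simp add: field_simps)
  show "e \<le> 1 / eigval S n" using b(1) ep pos by (simp add: field_simps)
qed

section \<open>Orthogonal splittings and block elimination\<close>

text \<open>The square matrix \<open>W = [Q, P]\<close> satisfies \<open>W\<^sup>T * W = 1\<close>,
  hence also \<open>W * W\<^sup>T = 1\<close>; splitting the latter sum over the columns gives the
  two projections.\<close>

lemma orthonormal_resolution: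
  fixes Q P :: "real mat"
  assumes Q: "Q \<in> carrier_mat (m + n) m" "Q\<^sup>T * Q = 1\<^sub>m m"
    and P: "P \<in> carrier_mat (m + n) n" "P\<^sup>T * P = 1\<^sub>m n"
    and PQ: "P\<^sup>T * Q = 0\<^sub>m n m"
  shows "Q * Q\<^sup>T + P * P\<^sup>T = 1\<^sub>m (m + n)"
proof -
  let ?d = "m + n"
  define W where "W = mat ?d ?d (\<lambda>(i, j). if j < m then Q $$ (i, j) else P $$ (i, j - m))"
  have W: "W \<in> carrier_mat ?d ?d" unfolding W_def by simp
  have col: "col W j = (if j < m then col Q j else col P (j - m))" if "j < ?d" for j
    by (rule eq_vecI) (use that Q P in \<open>auto simp: W_def\<close>)
  have qq: "col Q i \<bullet> col Q j = (if i = j then 1 else 0)" if "i < m" "j < m" for i j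
    using arg_cong[OF Q(2), of "\<lambda>M. M $$ (i, j)"] Q(1) that by simp
  have pp: "col P i \<bullet> col P j = (if i = j then 1 else 0)" if "i < n" "j < n" for i j
    using arg_cong[OF P(2), of "\<lambda>M. M $$ (i, j)"] P(1) that by simp
  have pq: "col P i \<bullet> col Q j = 0" if "i < n" "j < m" for i j
    using arg_cong[OF PQ, of "\<lambda>M. M $$ (i, j)"] P(1) Q(1) that by simp
  have qp: "col Q j \<bullet> col P i = 0" if "i < n" "j < m" for i j
    using pq[OF that] comm_scalar_prod[of "col Q j" ?d "col P i"] col_carrier_vec[of j m Q ?d]
      col_carrier_vec[of i n P ?d] Q(1) P(1) that by simp
  have "W\<^sup>T * W = 1\<^sub>m ?d"
    by (rule eq_matI) (use W col qq pp pq qp in auto)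
  then have WW: "W * W\<^sup>T = 1\<^sub>m ?d" by (rule mat_mult_left_right_inverse[rotated 2]) (use W in auto)
  have "Q * Q\<^sup>T + P * P\<^sup>T = W * W\<^sup>T"
  proof (rule eq_matI)
    fix i j assume "i < dim_row (W * W\<^sup>T)" "j < dim_col (W * W\<^sup>T)"
    then have ij: "i < ?d" "j < ?d" using W by auto
    have "(W * W\<^sup>T) $$ (i, j) = (\<Sum>l<m + n. W $$ (i, l) * W $$ (j, l))"
      using W ij by (simp add: scalar_prod_def atLeast0LessThan)
    also have "\<dots> = (\<Sum>l<m. W $$ (i, l) * W $$ (j, l)) + (\<Sum>l<n. W $$ (i, m + l) * W $$ (j, m + l))"
    proof -
      have "{..<m + n} = {..<m} \<union> {m..<m + n}" by auto
      moreover have "{..<m} \<inter> {m..<m + n} = {}" by auto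
      moreover have "(\<Sum>l\<in>{m..<m + n}. W $$ (i, l) * W $$ (j, l)) =
          (\<Sum>l<n. W $$ (i, m + l) * W $$ (j, m + l))"
        by (rule sum.reindex_bij_witness[of _ "\<lambda>l. m + l" "\<lambda>l. l - m"]) auto
      ultimately show ?thesis
        by (metis (no_types, lifting) finite_atLeastLessThan finite_lessThan sum.union_disjoint)
    qed
    also have "\<dots> = (\<Sum>l<m. Q $$ (i, l) * Q $$ (j, l)) + (\<Sum>l<n. P $$ (i, l) * P $$ (j, l))"
      using ij by (simp add: W_def)
    also have "\<dots> = (Q * Q\<^sup>T + P * P\<^sup>T) $$ (i, j)"
      using Q P ij by (simp add: scalar_prod_def atLeast0LessThan)
    finally show "(Q * Q\<^sup>T + P * P\<^sup>T) $$ (i, j) = (W * W\<^sup>T) $$ (i, j)" by simp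
  qed (use Q P W in auto)
  with WW show ?thesis by simp
qed

text \<open>The first claim completes the square in the block form of \<open>A\<close>. The second
  eliminates the off-diagonal block of the inverse from the two block rows of
  \<open>A * minv A = 1\<close> in the basis \<open>[Q, P]\<close>.\<close>

lemma schur_complement:
  fixes A Q P :: "real mat"
  assumes A: "A \<in> carrier_mat (m + n) (m + n)" "pos_def A"
    and Q: "Q \<in> carrier_mat (m + n) m" "Q\<^sup>T * Q = 1\<^sub>m m"
    and P: "P \<in> carrier_mat (m + n) n" "P\<^sup>T * P = 1\<^sub>m n"
    and PQ: "P\<^sup>T * Q = 0\<^sub>m n m" and m: "1 \<le> m"
  defines "T \<equiv> Q\<^sup>T * A * Q" and "C \<equiv> P\<^sup>T * A * Q"
  defines "S \<equiv> P\<^sup>T * A * P - C * minv T * C\<^sup>T"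
  shows "x \<in> carrier_vec n \<Longrightarrow>
      \<exists>w \<in> carrier_vec (m + n). x \<bullet> (S *\<^sub>v x) = w \<bullet> (A *\<^sub>v w) \<and> x \<bullet> x \<le> w \<bullet> w"
    and "S * (P\<^sup>T * minv A * P) = 1\<^sub>m n"
proof -
  let ?d = "m + n"
  have sym: "A\<^sup>T = A" using A(2) unfolding pos_def_def by blast
  have T: "T \<in> carrier_mat m m" unfolding T_def using A Q by auto
  have C: "C \<in> carrier_mat n m" unfolding C_def using A Q P by auto
  have CT: "C\<^sup>T = Q\<^sup>T * A * P"
    unfolding C_def using transpose_mult3[of "P\<^sup>T" n ?d A ?d Q m] P A Q sym by simp
  have pdT: "pos_def T"
    unfolding T_def by (rule pos_def_congruence[OF A Q m]) simp
  note Ti = pos_def_minv[OF T pdT] and AI = pos_def_minv[OF A]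
  let ?H = "P\<^sup>T * A * P" let ?Z = "C * minv T * C\<^sup>T"
  have H: "?H \<in> carrier_mat n n" using A P by auto
  have Z: "?Z \<in> carrier_mat n n" using C Ti(1) by auto
  have QP: "Q\<^sup>T * P = 0\<^sub>m m n"
    using arg_cong[OF PQ, of transpose_mat] transpose_mult[of "P\<^sup>T" n ?d Q m] P Q by simp
  {
    assume x: "x \<in> carrier_vec n"
    define z where "z = minv T *\<^sub>v (C\<^sup>T *\<^sub>v x)"
    have z: "z \<in> carrier_vec m" unfolding z_def using Ti(1) C x by simp
    \<comment> \<open>\<open>w\<close> is \<open>P x\<close> corrected along \<open>Q\<close> so that \<open>A w\<close> becomes orthogonal to the range of \<open>Q\<close>.\<close>
    define w where "w = P *\<^sub>v x - Q *\<^sub>v z"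
    have Px: "P *\<^sub>v x \<in> carrier_vec ?d" and Qz: "Q *\<^sub>v z \<in> carrier_vec ?d"
      using P Q x z by auto
    have w: "w \<in> carrier_vec ?d" unfolding w_def using Px Qz by simp
    have Aw: "A *\<^sub>v w = A *\<^sub>v (P *\<^sub>v x) - A *\<^sub>v (Q *\<^sub>v z)"
      unfolding w_def by (rule mult_minus_distrib_mat_vec[OF A(1) Px Qz])
    have "Q\<^sup>T *\<^sub>v (A *\<^sub>v w) = Q\<^sup>T *\<^sub>v (A *\<^sub>v (P *\<^sub>v x)) - Q\<^sup>T *\<^sub>v (A *\<^sub>v (Q *\<^sub>v z))"
      unfolding Aw by (rule mult_minus_distrib_mat_vec) (use A Q P x z in auto)
    also have "Q\<^sup>T *\<^sub>v (A *\<^sub>v (P *\<^sub>v x)) = C\<^sup>T *\<^sub>v x"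
      unfolding CT using A Q P x
      by (simp add: assoc_mult_mat_vec[of _ m ?d _ n] assoc_mult_mat_vec[of _ m ?d _ ?d])
    also have "Q\<^sup>T *\<^sub>v (A *\<^sub>v (Q *\<^sub>v z)) = T *\<^sub>v z"
      unfolding T_def using A Q z
      by (simp add: assoc_mult_mat_vec[of _ m ?d _ m] assoc_mult_mat_vec[of _ m ?d _ ?d])
    also have "T *\<^sub>v z = C\<^sup>T *\<^sub>v x"
      unfolding z_def using assoc_mult_mat_vec[OF T Ti(1), of "C\<^sup>T *\<^sub>v x"] Ti(2) C x by simp
    also have "C\<^sup>T *\<^sub>v x - C\<^sup>T *\<^sub>v x = 0\<^sub>v m" using C x by simp
    finally have QAw: "Q\<^sup>T *\<^sub>v (A *\<^sub>v w) = 0\<^sub>v m" .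
    have "P\<^sup>T *\<^sub>v (A *\<^sub>v w) = P\<^sup>T *\<^sub>v (A *\<^sub>v (P *\<^sub>v x)) - P\<^sup>T *\<^sub>v (A *\<^sub>v (Q *\<^sub>v z))"
      unfolding Aw by (rule mult_minus_distrib_mat_vec) (use A Q P x z in auto)
    also have "P\<^sup>T *\<^sub>v (A *\<^sub>v (P *\<^sub>v x)) = ?H *\<^sub>v x"
      using A P x
      by (simp add: assoc_mult_mat_vec[of _ n ?d _ n] assoc_mult_mat_vec[of _ n ?d _ ?d])
    also have "P\<^sup>T *\<^sub>v (A *\<^sub>v (Q *\<^sub>v z)) = C *\<^sub>v z"
      unfolding C_def using A P Q z
      by (simp add: assoc_mult_mat_vec[of _ n ?d _ m] assoc_mult_mat_vec[of _ n ?d _ ?d])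
    also have "C *\<^sub>v z = ?Z *\<^sub>v x"
      unfolding z_def using C Ti(1) x
      by (simp add: assoc_mult_mat_vec[of _ n m _ n] assoc_mult_mat_vec[of _ n m _ m])
    also have "?H *\<^sub>v x - ?Z *\<^sub>v x = S *\<^sub>v x"
      unfolding S_def by (rule minus_mult_distrib_mat_vec[symmetric, OF H Z x])
    finally have PAw: "P\<^sup>T *\<^sub>v (A *\<^sub>v w) = S *\<^sub>v x" .
    have Awc: "A *\<^sub>v w \<in> carrier_vec ?d" using A w by simp
    have "w \<bullet> (A *\<^sub>v w) = (P *\<^sub>v x) \<bullet> (A *\<^sub>v w) - (Q *\<^sub>v z) \<bullet> (A *\<^sub>v w)"
      unfolding w_def
      by (rule minus_scalar_prod_distrib[OF Px Qz Awc[unfolded w_def]])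
    also have "(P *\<^sub>v x) \<bullet> (A *\<^sub>v w) = x \<bullet> (S *\<^sub>v x)"
      using scalar_prod_adjoint[of "P\<^sup>T" n ?d x "A *\<^sub>v w"] P x Awc PAw by simp
    also have "(Q *\<^sub>v z) \<bullet> (A *\<^sub>v w) = 0"
      using scalar_prod_adjoint[of "Q\<^sup>T" m ?d z "A *\<^sub>v w"] Q z Awc QAw by simp
    finally have 1: "x \<bullet> (S *\<^sub>v x) = w \<bullet> (A *\<^sub>v w)" by simp
    have PP: "(P *\<^sub>v x) \<bullet> (P *\<^sub>v x) = x \<bullet> x"
      using scalar_prod_adjoint[of "P\<^sup>T" n ?d x "P *\<^sub>v x"] assoc_mult_mat_vec[of "P\<^sup>T" n ?d P n x] P x
      by simp
    have "0\<^sub>m m n *\<^sub>v x = 0\<^sub>v m" using x by (intro eq_vecI) auto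
    then have "Q\<^sup>T *\<^sub>v (P *\<^sub>v x) = 0\<^sub>v m"
      using assoc_mult_mat_vec[of "Q\<^sup>T" m ?d P n x] P Q x QP by (metis transpose_carrier_mat)
    then have "(Q *\<^sub>v z) \<bullet> (P *\<^sub>v x) = 0"
      using scalar_prod_adjoint[of "Q\<^sup>T" m ?d z "P *\<^sub>v x"] Q Px z by simp
    moreover have "(P *\<^sub>v x) \<bullet> (Q *\<^sub>v z) = (Q *\<^sub>v z) \<bullet> (P *\<^sub>v x)"
      by (rule comm_scalar_prod[OF Px Qz])
    \<comment> \<open>Pythagoras: the mixed terms vanish, so the correction \<open>Q z\<close> can
      only lengthen \<open>w\<close>.\<close>
    moreover have "w \<bullet> w = ((P *\<^sub>v x) \<bullet> (P *\<^sub>v x) - (P *\<^sub>v x) \<bullet> (Q *\<^sub>v z))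
        - ((Q *\<^sub>v z) \<bullet> (P *\<^sub>v x) - (Q *\<^sub>v z) \<bullet> (Q *\<^sub>v z))"
      unfolding w_def using Px Qz
      by (simp add: minus_scalar_prod_distrib[of _ ?d] scalar_prod_minus_distrib[of _ ?d])
    ultimately have "x \<bullet> x \<le> w \<bullet> w"
      using PP scalar_prod_self_nonneg[of "Q *\<^sub>v z"] by simp
    with 1 w show "\<exists>w \<in> carrier_vec ?d. x \<bullet> (S *\<^sub>v x) = w \<bullet> (A *\<^sub>v w) \<and> x \<bullet> x \<le> w \<bullet> w"
      by blast
  }
  \<comment> \<open>These are the two blocks of the \<open>P\<close> column of \<open>minv A\<close>
    in the basis \<open>[Q, P]\<close>.\<close>
  define X R where "X = Q\<^sup>T * minv A * P" and "R = P\<^sup>T * minv A * P"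
  have X: "X \<in> carrier_mat m n" and R: "R \<in> carrier_mat n n"
    unfolding X_def R_def using Q P AI by auto
  have AIP: "minv A * P \<in> carrier_mat ?d n" using AI P by simp
  have QX: "Q * X = Q * Q\<^sup>T * (minv A * P)"
    unfolding X_def using assoc_mult_mat[of "Q\<^sup>T" m ?d "minv A" ?d P n]
      assoc_mult_mat[of Q ?d m "Q\<^sup>T" ?d "minv A * P" n] Q(1) AI(1) P(1) AIP by (simp only: transpose_carrier_mat)
  have PR: "P * R = P * P\<^sup>T * (minv A * P)"
    unfolding R_def using assoc_mult_mat[of "P\<^sup>T" n ?d "minv A" ?d P n]
      assoc_mult_mat[of P ?d n "P\<^sup>T" ?d "minv A * P" n] AI(1) P(1) AIP by (simp only: transpose_carrier_mat)
  have "Q * X + P * R = (Q * Q\<^sup>T + P * P\<^sup>T) * (minv A * P)"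
    unfolding QX PR
    by (rule add_mult_distrib_mat[OF _ _ AIP, of _ ?d, symmetric]) (use Q(1) P(1) in auto)
  also have "\<dots> = minv A * P" unfolding orthonormal_resolution[OF Q P PQ] by (rule left_mult_one_mat[OF AIP])
  finally have res: "Q * X + P * R = minv A * P" .
  \<comment> \<open>One identity serves both block rows: \<open>M = Q\<close> gives the row with
    right-hand side zero, \<open>M = P\<close> the one with the identity.\<close>
  have split: "(M\<^sup>T * A * Q) * X + (M\<^sup>T * A * P) * R = M\<^sup>T * P"
    if M: "M \<in> carrier_mat ?d k" for M :: "real mat" and k
  proof -
    have MA: "M\<^sup>T * A \<in> carrier_mat k ?d" using M A by simp
    have "(M\<^sup>T * A * Q) * X + (M\<^sup>T * A * P) * R = M\<^sup>T * A * (Q * X) + M\<^sup>T * A * (P * R)"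
      using assoc_mult_mat[OF MA Q(1) X] assoc_mult_mat[OF MA P(1) R] by simp
    also have "\<dots> = M\<^sup>T * A * (Q * X + P * R)"
      by (rule mult_add_distrib_mat[symmetric]) (use MA Q P X R in auto)
    also have "\<dots> = M\<^sup>T * (A * (minv A * P))"
      unfolding res by (rule assoc_mult_mat) (use M A AIP in auto)
    also have "A * (minv A * P) = A * minv A * P"
      by (rule assoc_mult_mat[symmetric]) (use A AI P in auto)
    finally show ?thesis using AI(2) P by simp
  qed
  have "T * X + C\<^sup>T * R = 0\<^sub>m m n" using split[OF Q(1)] unfolding T_def CT QP .
  then have "minv T * (T * X + C\<^sup>T * R) = 0\<^sub>m m n" using Ti(1) by simp
  moreover have "minv T * (T * X + C\<^sup>T * R) = minv T * (T * X) + minv T * (C\<^sup>T * R)"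
    by (rule mult_add_distrib_mat) (use Ti(1) T X C R in auto)
  moreover have "minv T * (T * X) = minv T * T * X"
    by (rule assoc_mult_mat[symmetric]) (use Ti(1) T X in auto)
  ultimately have "X + minv T * (C\<^sup>T * R) = 0\<^sub>m m n" using Ti(3) X by simp
  then have "C * (X + minv T * (C\<^sup>T * R)) = 0\<^sub>m n n" using C by simp
  moreover have "C * (X + minv T * (C\<^sup>T * R)) = C * X + C * (minv T * (C\<^sup>T * R))"
    by (rule mult_add_distrib_mat) (use Ti(1) X C R in auto)
  moreover have "C * (minv T * (C\<^sup>T * R)) = ?Z * R"
    using C Ti(1) R
    by (simp add: assoc_mult_mat[of _ n m _ n _ n] assoc_mult_mat[of _ n m _ m _ n]
        assoc_mult_mat[of _ m m _ n _ n])
  ultimately have E1: "C * X + ?Z * R = 0\<^sub>m n n" by simp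
  have E2: "C * X + ?H * R = 1\<^sub>m n" using split[OF P(1)] unfolding P(2) C_def .
  \<comment> \<open>The common term \<open>C * X\<close> cancels when \<open>E1\<close> is
    subtracted from \<open>E2\<close>.\<close>
  have "S * R = ?H * R - ?Z * R"
    unfolding S_def by (rule minus_mult_distrib_mat[OF H Z R])
  also have "\<dots> = 1\<^sub>m n"
  proof (rule eq_matI)
    fix i j assume "i < dim_row (1\<^sub>m n :: real mat)" "j < dim_col (1\<^sub>m n :: real mat)"
    then have ij: "i < n" "j < n" by auto
    have c: "C * X \<in> carrier_mat n n" "?H * R \<in> carrier_mat n n" "?Z * R \<in> carrier_mat n n"
      using C X H Z R by auto
    have "(C * X) $$ (i, j) + (?Z * R) $$ (i, j) = 0"
      using arg_cong[OF E1, of "\<lambda>M. M $$ (i, j)"] c ij by (simp del: index_mult_mat)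
    moreover have "(C * X) $$ (i, j) + (?H * R) $$ (i, j) = 1\<^sub>m n $$ (i, j)"
      using arg_cong[OF E2, of "\<lambda>M. M $$ (i, j)"] c ij by (simp del: index_mult_mat)
    moreover have "(?H * R - ?Z * R) $$ (i, j) = (?H * R) $$ (i, j) - (?Z * R) $$ (i, j)"
      using c ij by (simp del: index_mult_mat)
    ultimately show "(?H * R - ?Z * R) $$ (i, j) = 1\<^sub>m n $$ (i, j)" by linarith
  qed (use H Z R C Ti(1) in auto)
  finally show "S * (P\<^sup>T * minv A * P) = 1\<^sub>m n" unfolding R_def .
qed

section \<open>From the Lanczos relation to a rank-one Schur complement\<close>

lemma orthogonal_col_space:
  fixes P Q :: "real mat"
  assumes P: "P \<in> carrier_mat d n" and Q: "Q \<in> carrier_mat d m"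
    and orth: "vec_space.col_space d P \<subseteq> vec_module.orthogonal_complement d (vec_space.col_space d Q)"
  shows "P\<^sup>T * Q = 0\<^sub>m n m"
proof -
  interpret vec_space "TYPE(real)" d .
  have "col P i \<in> col_space P" if "i < n" for i
    unfolding col_space_def using in_own_span[of "set (cols P)"] cols_dim[of P] P that
    by (auto simp: cols_def)
  moreover have "col Q j \<in> col_space Q" if "j < m" for j
    unfolding col_space_def using in_own_span[of "set (cols Q)"] cols_dim[of Q] Q that
    by (auto simp: cols_def)
  ultimately have "col P i \<bullet> col Q j = 0" if "i < n" "j < m" for i j
    using orth that unfolding orthogonal_complement_def by blast
  then show ?thesis by (intro eq_matI) (use P Q in auto)
qed

lemma mult_outer_prod:
  assumes M: "M \<in> carrier_mat n k" and x: "x \<in> carrier_vec k"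
  shows "M * outer_prod x y = outer_prod (M *\<^sub>v x) y"
  by (rule eq_matI)
    (use M x in \<open>auto simp: outer_prod_def scalar_prod_def sum_distrib_right mult.assoc\<close>)

text \<open>The unit vector picks out a single diagonal entry of \<open>M\<close>. With the inverse
  of \<open>T\<close> as \<open>M\<close> and \<open>k = m - 1\<close>, the Schur correction becomes
  \<gamma> times the outer product of the first coordinate vector with itself.\<close>

lemma smult_outer_prod_congruence:
  assumes M: "M \<in> carrier_mat m m" and u: "u \<in> carrier_vec n" and k: "k < m"
  shows "(b \<cdot>\<^sub>m outer_prod u (unit_vec m k)) * M * (b \<cdot>\<^sub>m outer_prod u (unit_vec m k))\<^sup>T =
    (b\<^sup>2 * M $$ (k, k)) \<cdot>\<^sub>m outer_prod u u"
proof -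
  let ?C = "b \<cdot>\<^sub>m outer_prod u (unit_vec m k)"
  have C: "?C \<in> carrier_mat n m" using outer_prod_carrier[of u "unit_vec m k"] u by simp
  define X where "X = ?C * M"
  have X: "X \<in> carrier_mat n m" unfolding X_def using C M by simp
  have CM: "X $$ (i, l) = b * u $ i * M $$ (k, l)" if "i < n" "l < m" for i l
  proof -
    have "X $$ (i, l) = (\<Sum>r<m. b * u $ i * (if r = k then 1 else 0) * M $$ (r, l))"
      unfolding X_def using that C M u k by (simp add: scalar_prod_def outer_prod_def atLeast0LessThan mult.assoc)
    also have "\<dots> = (\<Sum>r<m. if r = k then b * u $ i * M $$ (r, l) else 0)"
      by (rule sum.cong) auto
    finally show ?thesis using k by simp
  qed
  show ?thesis unfolding X_def[symmetric]
  proof (rule eq_matI)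
    fix i j assume "i < dim_row ((b\<^sup>2 * M $$ (k, k)) \<cdot>\<^sub>m outer_prod u u)"
      "j < dim_col ((b\<^sup>2 * M $$ (k, k)) \<cdot>\<^sub>m outer_prod u u)"
    then have ij: "i < n" "j < n" using u by (auto simp: outer_prod_def)
    have "(X * ?C\<^sup>T) $$ (i, j) = (\<Sum>r<m. X $$ (i, r) * ?C $$ (j, r))"
      using ij C X by (simp add: scalar_prod_def atLeast0LessThan del: index_smult_mat)
    also have "\<dots> = (\<Sum>r<m. if r = k then b * u $ i * M $$ (k, r) * (b * u $ j) else 0)"
      using ij CM u k by (intro sum.cong) (auto simp: outer_prod_def)
    also have "\<dots> = b * u $ i * M $$ (k, k) * (b * u $ j)" using k by simp
    finally show "(X * ?C\<^sup>T) $$ (i, j) = ((b\<^sup>2 * M $$ (k, k)) \<cdot>\<^sub>m outer_prod u u) $$ (i, j)"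
      using ij u by (simp add: outer_prod_def power2_eq_square)
  qed (use C X u in \<open>auto simp: outer_prod_def\<close>)
qed

theorem proposition10:
  fixes A Q T Qp Tp S :: "real mat"
    and vref :: "real vec"
    and q :: "nat \<Rightarrow> real vec"
    and \<beta> :: "nat \<Rightarrow> real"
    and \<gamma> :: real
    and d m :: nat
  assumes "1 \<le> m" and "m < d"
    and A: "A \<in> carrier_mat d d" "pos_def A"
    and vref: "vref \<in> carrier_vec d" "vref \<noteq> 0\<^sub>v d"
    and lanczos: "lanczos A vref m q \<beta>"
    and Q: "Q = mat_of_cols d (map q [1..<Suc m])"
    and T: "T = Q\<^sup>T * A * Q"
    and Qp: "Qp \<in> carrier_mat d (d - m)" "Qp\<^sup>T * Qp = 1\<^sub>m (d - m)"
      "vec_space.col_space d Qp = vec_module.orthogonal_complement d (vec_space.col_space d Q)"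
      "col Qp 0 = q (Suc m)"
    and Tp: "Tp = Qp\<^sup>T * A * Qp"
    and \<gamma>: "\<gamma> = (\<beta> m)\<^sup>2 * minv T $$ (m - 1, m - 1)"
    and S: "S = Tp - \<gamma> \<cdot>\<^sub>m outer_prod (unit_vec (d - m) 0) (unit_vec (d - m) 0)"
  shows
    \<comment> \<open>signs asserted in the set-up\<close>
    "(0 < eigval Tp (d - m) \<and> 0 \<le> \<gamma> \<and> 0 < eigval A d) \<and>
    \<comment> \<open>(i)\<close>
    ((\<forall>j \<in> {1..d - m}. eigval Tp j \<ge> eigval S j \<and>
        eigval S j \<ge> (if j = d - m then 0 else eigval Tp (j + 1))) \<and>
      eigval S 1 \<le> eigval Tp 1) \<and>
    \<comment> \<open>(ii)\<close>
    ((pos_def S \<longleftrightarrow> \<gamma> * minv Tp $$ (0, 0) < 1) \<and>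
      \<gamma> * minv Tp $$ (0, 0) < 1 \<and>
      invertible_mat S \<and> minv S = Qp\<^sup>T * minv A * Qp) \<and>
    \<comment> \<open>(iii)\<close>
    eigval S (d - m) \<ge> eigval A d \<and>
    \<comment> \<open>(iv)\<close>
    (cond_num S \<le> eigval Tp 1 / eigval A d \<and>
      eigval Tp 1 / eigval A d \<le> cond_num A) \<and>
    \<comment> \<open>(v)\<close>
    (2 \<le> d - m \<longrightarrow>
      (\<forall>uhat V D.
        uhat = (1 / vnorm (minv S *\<^sub>v unit_vec (d - m) 0)) \<cdot>\<^sub>v (minv S *\<^sub>v unit_vec (d - m) 0) \<longrightarrow>
        V \<in> carrier_mat (d - m) (d - m - 1) \<longrightarrow>
        V\<^sup>T * V = 1\<^sub>m (d - m - 1) \<longrightarrow>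
        vec_space.col_space (d - m) V = vec_module.orthogonal_complement (d - m) {uhat} \<longrightarrow>
        D = V\<^sup>T * minv S * V \<longrightarrow>
        (\<forall>i \<in> {1..d - m - 1}.
          eigval (minv S) i \<ge> eigval D i \<and> eigval D i \<ge> eigval (minv S) (i + 1)) \<and>
        (\<forall>i \<in> {1..d - m - 1}.
          eigval D i \<in> {1 / eigval S 1 .. 1 / eigval S (d - m)}) \<and>
        eigval D 1 / eigval D (d - m - 1) \<le> cond_num S))"
proof -
  \<comment> \<open>Writing \<open>d\<close> as \<open>m + n\<close> matches the block sizes used
    for the Schur complement.\<close>
  define n where "n = d - m"
  have n: "1 \<le> n" "d = m + n" "d - m = n" using assms(1,2) unfolding n_def by auto
  have sym: "A\<^sup>T = A" using A(2) unfolding pos_def_def by blast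
  note A' = A[unfolded n(2)]
  note Qp' = Qp[unfolded n(3)] Qp(1,3)[unfolded n(3), unfolded n(2)]
  note dec = lanczos_decomposition[OF A(1) sym vref lanczos Q assms(1)]
  have Qc: "Q \<in> carrier_mat (m + n) m" using dec(1) n(2) by simp
  have Pc: "Qp \<in> carrier_mat (m + n) n" using Qp'(1) n(2) by simp
  have PQ: "Qp\<^sup>T * Q = 0\<^sub>m n m"
    by (rule orthogonal_col_space[OF Qp(1) dec(1), unfolded n(3)]) (use Qp(3) in simp)
  define e where "e = (unit_vec n 0 :: real vec)"
  have e: "e \<in> carrier_vec n" unfolding e_def by simp
  \<comment> \<open>The next Lanczos vector is the first column of \<open>Qp\<close>, so its
    coordinates in that basis are the first unit vector.\<close>
  have Pq: "Qp\<^sup>T *\<^sub>v q (Suc m) = e"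
  proof -
    have "Qp\<^sup>T *\<^sub>v col Qp 0 = col (Qp\<^sup>T * Qp) 0" using Pc n(1) by (subst col_mult2) auto
    then show ?thesis unfolding Qp'(2,4) e_def using n(1) by simp
  qed
  define C where "C = Qp\<^sup>T * A * Q"
  \<comment> \<open>Multiplying the Lanczos relation by the transpose of \<open>Qp\<close> removes
    the term in the range of \<open>Q\<close>; only the rank-one remainder survives.\<close>
  have C: "C = \<beta> m \<cdot>\<^sub>m outer_prod e (unit_vec m (m - 1))"
  proof -
    have qc: "q (Suc m) \<in> carrier_vec d" using Qp'(1,4) by (metis col_dim carrier_matD(1))
    let ?O = "outer_prod (q (Suc m)) (unit_vec m (m - 1))"
    have O: "?O \<in> carrier_mat d m" using outer_prod_carrier[of "q (Suc m)" "unit_vec m (m - 1)"] qc by simp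
    have PT: "Qp\<^sup>T \<in> carrier_mat n d" using Qp'(1) by simp
    have Tc: "Q\<^sup>T * A * Q \<in> carrier_mat m m" using dec(1) A(1) by auto
    have "C = Qp\<^sup>T * (A * Q)" unfolding C_def by (rule assoc_mult_mat[OF PT A(1) dec(1)])
    also have "\<dots> = Qp\<^sup>T * (Q * (Q\<^sup>T * A * Q)) + Qp\<^sup>T * (\<beta> m \<cdot>\<^sub>m ?O)"
      unfolding arg_cong[OF dec(3), of "\<lambda>M. Qp\<^sup>T * M"]
      by (rule mult_add_distrib_mat[OF PT mult_carrier_mat[OF dec(1) Tc] smult_carrier_mat[OF O]])
    also have "Qp\<^sup>T * (Q * (Q\<^sup>T * A * Q)) = 0\<^sub>m n m"
      using assoc_mult_mat[OF PT dec(1) Tc] left_mult_zero_mat[OF Tc, of n] PQ by metis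
    also have "Qp\<^sup>T * (\<beta> m \<cdot>\<^sub>m ?O) = \<beta> m \<cdot>\<^sub>m outer_prod e (unit_vec m (m - 1))"
    proof -
      have "Qp\<^sup>T * ?O = outer_prod (Qp\<^sup>T *\<^sub>v q (Suc m)) (unit_vec m (m - 1))"
        by (rule mult_outer_prod[OF PT qc])
      then show ?thesis unfolding Pq using mult_smult_distrib[OF PT O] by simp
    qed
    finally show ?thesis using outer_prod_carrier[of e "unit_vec m (m - 1)"] e by simp
  qed
  have Tc: "T \<in> carrier_mat m m" unfolding T using Qc A(1) n(2) by auto
  have pdT: "pos_def T"
    unfolding T by (rule pos_def_congruence[OF A' Qc dec(2) assms(1)]) simp
  note Ti = pos_def_minv[OF Tc pdT]
  have g0: "0 \<le> \<gamma>"
    unfolding \<gamma> using minv_diag_form(4)[OF Tc pdT, of "m - 1"] assms(1) by (simp add: less_imp_le)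
  have Tpc: "Tp \<in> carrier_mat n n" and Tpsym: "Tp\<^sup>T = Tp"
    unfolding Tp using A'(1) Pc congruence_symmetric[OF A'(1) sym Pc] by auto
  have S': "S = Tp - \<gamma> \<cdot>\<^sub>m outer_prod e e" unfolding S n(3) e_def ..
  have Sschur: "S = Qp\<^sup>T * A * Qp - C * minv (Q\<^sup>T * A * Q) * C\<^sup>T"
  proof -
    have "C * minv T * C\<^sup>T = \<gamma> \<cdot>\<^sub>m outer_prod e e"
      unfolding C \<gamma> by (rule smult_outer_prod_congruence[OF Ti(1) e]) (use assms(1) in simp)
    then show ?thesis unfolding S' Tp[symmetric] T[symmetric] by simp
  qed
  note schur = schur_complement[OF A' Qc dec(2) Pc Qp'(2) PQ assms(1), folded C_def, folded Sschur]
  define R where "R = Qp\<^sup>T * minv A * Qp"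
  have AI: "minv A \<in> carrier_mat (m + n) (m + n)" "(minv A)\<^sup>T = minv A"
    using pos_def_minv[OF A'] by auto
  have R: "R \<in> carrier_mat n n" "R\<^sup>T = R"
    unfolding R_def using AI Pc congruence_symmetric[OF AI Pc] by auto
  have SR: "S * R = 1\<^sub>m n" using schur(2) unfolding R_def .
  have Sc: "S \<in> carrier_mat n n" unfolding S' using Tpc outer_prod_carrier[of e e] e by auto
  have Ssym: "S\<^sup>T = S" unfolding S' by (rule rank_one_update_symmetric[OF Tpc Tpsym e])
  have minvS: "minv S = R" by (rule minv_eqI[OF Sc R(1) SR])
  have RS: "R * S = 1\<^sub>m n" by (rule mat_mult_left_right_inverse[OF Sc R(1) SR])
  have invS: "invertible_mat S"
    unfolding invertible_mat_def inverts_mat_def using Sc R SR RS by auto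

  \<comment> \<open>Spectral floor and positivity\<close>
  have Ad: "0 < eigval A d" using pos_def_iff_eigval[OF A(1) sym] A(2) n by simp
  \<comment> \<open>The form of \<open>S\<close> at \<open>x\<close> is the form of \<open>A\<close>
    at some \<open>w\<close> no shorter than \<open>x\<close>; since the smallest eigenvalue of
    \<open>A\<close> is positive, passing from \<open>x\<close> to \<open>w\<close> preserves the
    bound.\<close>
  have floor: "eigval A d \<le> eigval S n"
  proof (rule eigenvalue_ge[OF Sc eigenvalue_eigval[OF Sc Ssym n(1) order_refl]])
    fix x :: "real vec" assume x: "x \<in> carrier_vec n"
    obtain w where w: "w \<in> carrier_vec d" "x \<bullet> (S *\<^sub>v x) = w \<bullet> (A *\<^sub>v w)" "x \<bullet> x \<le> w \<bullet> w"
      using schur(1)[OF x] n(2) by auto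
    have "eigval A d * (x \<bullet> x) \<le> eigval A d * (w \<bullet> w)" using Ad w(3) by simp
    also have "\<dots> \<le> x \<bullet> (S *\<^sub>v x)" unfolding w(2) by (rule eigval_le_rayleigh[OF A(1) sym w(1)])
    finally show "eigval A d * (x \<bullet> x) \<le> x \<bullet> (S *\<^sub>v x)" .
  qed
  have Sn: "0 < eigval S n" using Ad floor by linarith
  have S1: "0 < eigval S 1" using Sn eigval_mono[OF Sc Ssym, of 1 n] n(1) by linarith
  have pdS: "pos_def S" using pos_def_iff_eigval[OF Sc Ssym n(1)] Sn by simp
  have pdTp: "pos_def Tp"
    unfolding Tp by (rule pos_def_congruence[OF A' Pc Qp'(2) n(1)]) simp
  have Tpn: "0 < eigval Tp n" using pos_def_iff_eigval[OF Tpc Tpsym n(1)] pdTp by simp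
  note rk = rank_one_interlacing[OF Tpc Tpsym e g0, folded S']
  have Tp1: "eigval Tp 1 \<le> eigval A 1"
    unfolding Tp using cauchy_interlacing(1)[OF A'(1) sym Pc Qp'(2), of 1] n(1) by simp
  \<comment> \<open>Testing the positive definite \<open>S\<close> at \<open>y\<close>, the first
    column of the inverse of \<open>Tp\<close>, gives \<open>t * (1 - \<gamma> * t) > 0\<close> with
    \<open>t > 0\<close>. As \<open>pos_def S\<close> is already known, both sides of the
    equivalence in (ii) hold.\<close>
  have gam: "\<gamma> * minv Tp $$ (0, 0) < 1"
  proof -
    let ?t = "minv Tp $$ (0, 0)"
    define y where "y = minv Tp *\<^sub>v unit_vec n 0"
    have "0 < n" using n(1) by simp
    note y = minv_diag_form[OF Tpc pdTp this, folded y_def]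
    have "y \<noteq> 0\<^sub>v n" using y(2,4) \<open>0 < n\<close> by auto
    then have "0 < y \<bullet> (S *\<^sub>v y)" using pdS Sc y(1) unfolding pos_def_def by auto
    also have "y \<bullet> (S *\<^sub>v y) = ?t - \<gamma> * ?t\<^sup>2"
      unfolding S' rank_one_form[OF Tpc e y(1)] y(3) unfolding e_def
      using y(1,2) \<open>0 < n\<close> by (simp add: scalar_prod_left_unit[of _ n])
    also have "\<dots> = ?t * (1 - \<gamma> * ?t)" by (simp add: algebra_simps power2_eq_square)
    finally show ?thesis using y(4) by (simp add: zero_less_mult_iff)
  qed

  \<comment> \<open>Assembly of the eigenvalue and condition number bounds\<close>
  have condS: "cond_num S = eigval S 1 / eigval S n" unfolding cond_num_def using Sc by simp
  \<comment> \<open>At \<open>j = n\<close> the lower bound is the conventional value 0, supplied by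
    positivity of \<open>S\<close> instead of interlacing.\<close>
  have i: "\<forall>j \<in> {1..n}. eigval Tp j \<ge> eigval S j \<and>
      eigval S j \<ge> (if j = n then 0 else eigval Tp (j + 1))"
    using rk Sn by auto
  have v: "(\<forall>i \<in> {1..n - 1}. eigval R i \<ge> eigval (V\<^sup>T * R * V) i \<and>
        eigval (V\<^sup>T * R * V) i \<ge> eigval R (i + 1)) \<and>
      (\<forall>i \<in> {1..n - 1}. eigval (V\<^sup>T * R * V) i \<in> {1 / eigval S 1 .. 1 / eigval S n}) \<and>
      eigval (V\<^sup>T * R * V) 1 / eigval (V\<^sup>T * R * V) (n - 1) \<le> cond_num S"
    if n2: "2 \<le> n" and V: "V \<in> carrier_mat n (n - 1)" "V\<^sup>T * V = 1\<^sub>m (n - 1)" for V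
  proof -
    let ?D = "V\<^sup>T * R * V"
    \<comment> \<open>\<open>V\<close> has codimension one, so the shift in Cauchy interlacing is
      \<open>n - (n - 1) = 1\<close>.\<close>
    have il: "eigval ?D i \<le> eigval R i" "eigval R (i + 1) \<le> eigval ?D i" if "i \<in> {1..n - 1}" for i
      using cauchy_interlacing[OF R V, of i] that n(1) by auto
    have Rb: "1 / eigval S 1 \<le> eigval R j" "eigval R j \<le> 1 / eigval S n" if "1 \<le> j" "j \<le> n" for j
      using eigenvalue_inverse_bounds[OF Sc Ssym R(1) SR Sn eigenvalue_eigval[OF R that]] by auto
    have Db: "1 / eigval S 1 \<le> eigval ?D i \<and> eigval ?D i \<le> 1 / eigval S n"
      if i: "i \<in> {1..n - 1}" for i
    proof -
      have "i \<le> n" "i + 1 \<le> n" "1 \<le> i" using i n2 by auto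
      then show ?thesis using il[OF i] Rb(2)[of i] Rb(1)[of "i + 1"] by linarith
    qed
    \<comment> \<open>The quotient is at most the upper end of the interval divided by its lower
      end, which is the condition number of \<open>S\<close>.\<close>
    have "eigval ?D 1 / eigval ?D (n - 1) \<le> (1 / eigval S n) / (1 / eigval S 1)"
      using Db[of 1] Db[of "n - 1"] n2 S1 Sn by (intro frac_le) auto
    then have "eigval ?D 1 / eigval ?D (n - 1) \<le> cond_num S" unfolding condS by simp
    with il Db show ?thesis by auto
  qed
  \<comment> \<open>Interlacing bounds the numerator from above, the spectral floor bounds the
    denominator from below.\<close>
  have iv: "cond_num S \<le> eigval Tp 1 / eigval A d"
    unfolding condS using rk(1)[of 1] n(1) Ad floor S1 by (intro frac_le) auto
  have iv': "eigval Tp 1 / eigval A d \<le> cond_num A"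
    unfolding cond_num_def using Tp1 Ad A(1) by (simp add: divide_right_mono)
  show ?thesis
    unfolding n(3) minvS R_def[symmetric]
    using Tpn g0 Ad i rk(1)[of 1] n(1) pdS gam invS floor iv iv' v by auto
qed

end
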